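(* For every integer $n \ge 1$, the polynomial \[ I_n(t) = \sum_{\pi \in \mathcal{I}_n} t^{\operatorname{des}(\pi)} \] is $\gamma$-positive, where $\mathcal{I}_n$ is the set of involutions of $[n]=\{1,\dots,n\}$. That is, writing \[ I_n(t) = \sum_{k=0}^{\lfloor (n-1)/2 \rfloor} a_{n,k}\, t^k (1+t)^{n-1-2k}, \] all coefficients $a_{n,k}$ are nonnegative.
   Context: For a permutation $\pi$ of $[n]$, its descent set is $\operatorname{DES}(\pi)=\{i\in[n-1] : \pi(i)>\pi(i+1)\}$ and $\operatorname{des}(\pi)=\#\operatorname{DES}(\pi)$. The polynomial $I_n(t)$ is palindromic of center $(n-1)/2$, so it can be written uniquely in the form $\sum_{k} \gamma_k t^k(1+t)^{n-1-2k}$; a palindromic polynomial is called $\gamma$-positive if all $\gamma_k \ge 0$. *)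

theory Defs
  imports "HOL-Combinatorics.Permutations" "HOL-Computational_Algebra.Polynomial"
begin

text \<open>A permutation of \<open>[n]\<close> is a function on \<open>nat\<close> that permutes \<open>{1..n}\<close>,
  hence is the identity outside \<open>{1..n}\<close>.\<close>

definition involutions :: "nat \<Rightarrow> (nat \<Rightarrow> nat) set" where
  "involutions n = {\<pi>. \<pi> permutes {1..n} \<and> \<pi> \<circ> \<pi> = id}"

definition DES :: "nat \<Rightarrow> (nat \<Rightarrow> nat) \<Rightarrow> nat set" where
  "DES n \<pi> = {i \<in> {1..n - 1}. \<pi> i > \<pi> (i + 1)}"

definition des :: "nat \<Rightarrow> (nat \<Rightarrow> nat) \<Rightarrow> nat" where
  "des n \<pi> = card (DES n \<pi>)"

definition involution_des_poly :: "nat \<Rightarrow> int poly" where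
  "involution_des_poly n = (\<Sum>\<pi>\<in>involutions n. monom 1 (des n \<pi>))"

text \<open>The parameter \<open>d\<close> is twice the center of symmetry, so that no half-integers occur. The
  polynomial may have degree less than \<open>d\<close>, as \<open>t\<close> does for \<open>d = 2\<close>.\<close>

definition palindromic :: "nat \<Rightarrow> 'a::zero poly \<Rightarrow> bool" where
  "palindromic d p \<longleftrightarrow> degree p \<le> d \<and> (\<forall>i\<le>d. coeff p i = coeff p (d - i))"

definition gamma_expansion :: "nat \<Rightarrow> (nat \<Rightarrow> 'a::comm_ring_1) \<Rightarrow> 'a poly" where
  "gamma_expansion d \<gamma> = (\<Sum>k=0..d div 2. smult (\<gamma> k) ([:0, 1:] ^ k * [:1, 1:] ^ (d - 2 * k)))"

text \<open>By \<open>gamma_expansion_unique\<close> below, the coefficients \<open>\<gamma> k\<close> with \<open>k \<le> d div 2\<close> are determined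
  by \<open>p\<close>, so the existential quantifier makes no choice.\<close>

definition gamma_positive :: "nat \<Rightarrow> 'a::linordered_idom poly \<Rightarrow> bool" where
  "gamma_positive d p \<longleftrightarrow> palindromic d p \<and>
     (\<exists>\<gamma>. p = gamma_expansion d \<gamma> \<and> (\<forall>k\<le>d div 2. \<gamma> k \<ge> 0))"

lemma coeff_gamma_basis:
  fixes q :: "'a::comm_ring_1 poly"
  shows "coeff ([:0, 1:] ^ j * q) k = (if k < j then 0 else coeff q (k - j))"
  by (simp add: coeff_monom_mult flip: monom_altdef[of 1, simplified])

lemma gamma_expansion_unique:
  fixes \<gamma> \<delta> :: "nat \<Rightarrow> 'a::comm_ring_1"
  assumes eq: "gamma_expansion d \<gamma> = gamma_expansion d \<delta>" and "k \<le> d div 2"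
  shows "\<gamma> k = \<delta> k"
  using assms(2)
proof (induction k rule: less_induct)
  case (less k)
  let ?b = "\<lambda>j. coeff ([:0, 1:] ^ j * [:1, 1:] ^ (d - 2 * j) :: 'a poly) k"
  have b0: "?b j = 0" if "j > k" for j
    using that by (simp add: coeff_gamma_basis)
  have bk: "?b k = 1"
    by (simp add: coeff_gamma_basis coeff_0_power)
  have "0 = (\<Sum>j=0..d div 2. (\<gamma> j - \<delta> j) * ?b j)"
    using arg_cong[OF eq, of "\<lambda>p. coeff p k"]
    by (simp add: gamma_expansion_def coeff_sum left_diff_distrib sum_subtractf)
  also have "\<dots> = (\<Sum>j\<in>{k}. (\<gamma> j - \<delta> j) * ?b j)"
  proof (rule sum.mono_neutral_right)
    show "\<forall>j\<in>{0..d div 2} - {k}. (\<gamma> j - \<delta> j) * ?b j = 0"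
    proof
      fix j assume j: "j \<in> {0..d div 2} - {k}"
      show "(\<gamma> j - \<delta> j) * ?b j = 0"
      proof (cases "j < k")
        case True
        then show ?thesis using less.IH[of j] j by simp
      next
        case False
        then show ?thesis using b0[of j] j by simp
      qed
    qed
  qed (use less.prems in auto)
  finally show ?case by (simp add: bk)
qed

end

(* For a permutation with d descents, the words c_1 <= ... <= c_n over {0..<R} that increase strictly
   at the descents number (n + R - 1 - d choose n).  Pairs of an involution pi and such a word
   correspond to symmetric R x R matrices over the naturals with entry sum n, via
   M(x,y) = #{i. c_i = x, c_(pi i) = y}.  The number s_R(n) of these matrices has generating function
   (1-u)^(-R) (1-u^2)^(-R(R-1)/2) in u, whose logarithmic derivative yields
     n s_R(n) = R s_R(n-1) + (R^2 + n - 2) s_R(n-2).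
   Since sum_R s_R(n) t^R = t I_n(t) / (1-t)^(n+1), this is a recurrence for I_n, and in the gamma
   basis a five-term recurrence for the coefficients a(n,k).  It has a negative coefficient only if
   n - 2k is 1 or 2.  Positivity is therefore proved together with the bounds
     (3k+1) a(2k+1,k) <= 4 a(2k+1,k-1),
     (k+3) a(2k+2,k) <= 5 a(2k+2,k-1),
     (k+3) a(2k+3,k) <= 12 a(2k+3,k-1),
   which are self-propagating for large k and are checked directly for n <= 48. *)
theory Submission
  imports Defs "HOL-Library.Product_Lexorder" "HOL-Library.Multiset"
    "HOL-Computational_Algebra.Polynomial_FPS"
begin

subsection \<open>Symmetric matrices\<close>

text \<open>On series indexed by R, multiplication by R is the operator t d/dt, so the factors R and
  R^2 become one and two applications of it. With the denominator cleared, this operator sends t^k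
  (1+t)^(d-2k) to only two neighbouring basis elements, with coefficients k+1 and 2(d-2k). The term
  without R lacks two powers of the denominator, and the compensating (1-t)^2 = (1+t)^2 - 4t is the
  only source of negative terms. The bounds are dictated by the recurrence. Put h = (n-1) div 2. For
  odd n the last entry contains (4-6h) a(n-2,h-1) + 8 a(n-2,h-2), which is nonnegative exactly under
  the first bound for row n-2. Carrying the first bound over to row n leads to comparing 16(h+1)
  a(n-2,h-2) with 192 a(n-2,h-3), which is the third bound for row n-2. Carrying the third bound
  over requires control of the last two entries of the even row n-1, which is the second
  bound.\<close>

definition weighted_funs :: "'a set \<Rightarrow> ('a \<Rightarrow> nat) \<Rightarrow> nat \<Rightarrow> ('a \<Rightarrow> nat) set" where
  "weighted_funs A w n = {f. (\<forall>a. a \<notin> A \<longrightarrow> f a = 0) \<and> (\<Sum>a\<in>A. w a * f a) = n}"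

lemma finite_weighted_funs:
  assumes "finite A" "\<And>a. a \<in> A \<Longrightarrow> 0 < w a"
  shows "finite (weighted_funs A w n)"
proof (rule finite_subset)
  show "weighted_funs A w n \<subseteq> {f. \<forall>a. (a \<in> A \<longrightarrow> f a \<in> {..n}) \<and> (a \<notin> A \<longrightarrow> f a = 0)}"
  proof (clarsimp simp: weighted_funs_def)
    fix f a assume "a \<in> A"
    have "f a \<le> w a * f a" using assms(2)[OF \<open>a \<in> A\<close>] by simp
    also have "\<dots> \<le> (\<Sum>a\<in>A. w a * f a)"
      using \<open>a \<in> A\<close> assms(1) by (intro member_le_sum) auto
    finally show "f a \<le> (\<Sum>a\<in>A. w a * f a)" .
  qed
  show "finite {f. \<forall>a. (a \<in> A \<longrightarrow> f a \<in> {..n}) \<and> (a \<notin> A \<longrightarrow> f a = 0)}"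
    using assms(1) by (intro finite_set_of_finite_funs) simp_all
qed

text \<open>Either \<open>f a\<close> vanishes, or lowering it by one is reversible and costs
  \<open>w a\<close> of the total weight. In terms of series this is multiplication by 1 - X^(w
  a).\<close>

lemma card_weighted_funs_insert:
  assumes "finite A" "\<And>b. b \<in> insert a A \<Longrightarrow> 0 < w b" "a \<notin> A"
  shows "card (weighted_funs (insert a A) w n) = card (weighted_funs A w n)
    + (if w a \<le> n then card (weighted_funs (insert a A) w (n - w a)) else 0)"
proof -
  let ?P = "{f \<in> weighted_funs (insert a A) w n. f a > 0}"
  have sum_upd: "(\<Sum>b\<in>A. w b * (if b = a then x else f b)) = (\<Sum>b\<in>A. w b * f b)" for f x
    using assms(3) by (intro sum.cong) auto
  have split: "weighted_funs (insert a A) w n = weighted_funs A w n \<union> ?P"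
    using assms(1,3) by (auto simp: weighted_funs_def) (metis neq0_conv)
  have disj: "weighted_funs A w n \<inter> ?P = {}"
    using assms(3) by (auto simp: weighted_funs_def)
  have P: "card ?P = (if w a \<le> n then card (weighted_funs (insert a A) w (n - w a)) else 0)"
  proof (cases "w a \<le> n")
    case True
    have "bij_betw (\<lambda>f. f(a := f a - 1)) ?P (weighted_funs (insert a A) w (n - w a))"
    proof (rule bij_betw_byWitness[where f' = "\<lambda>f. f(a := Suc (f a))"])
      show "(\<lambda>f. f(a := f a - 1)) ` ?P \<subseteq> weighted_funs (insert a A) w (n - w a)"
        using assms(1,3) by (auto simp: weighted_funs_def sum_upd diff_mult_distrib2)
      show "(\<lambda>f. f(a := Suc (f a))) ` weighted_funs (insert a A) w (n - w a) \<subseteq> ?P"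
        using assms(1,3) True by (auto simp: weighted_funs_def sum_upd)
    qed auto
    then show ?thesis using True by (simp add: bij_betw_same_card)
  next
    case False
    have "w a * f a + (\<Sum>b\<in>A. w b * f b) \<noteq> n" if "f a > 0" for f
      using False that by (cases "f a") auto
    then have "?P = {}" using assms(1,3) by (auto simp: weighted_funs_def)
    then show ?thesis using False by (simp only: card.empty if_False)
  qed
  have fin: "finite (weighted_funs (insert a A) w n)"
    using assms by (intro finite_weighted_funs) auto
  then have "finite (weighted_funs A w n)" "finite ?P"
    using split by (metis finite_Un)+
  then show ?thesis
    using card_Un_disjoint[OF _ _ disj] split P by simp
qed

definition weighted_gf :: "'a set \<Rightarrow> ('a \<Rightarrow> nat) \<Rightarrow> int fps" where
  "weighted_gf A w = Abs_fps (\<lambda>n. int (card (weighted_funs A w n)))"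

lemma weighted_gf_insert:
  assumes "finite A" "\<And>b. b \<in> insert a A \<Longrightarrow> 0 < w b" "a \<notin> A"
  shows "weighted_gf A w = weighted_gf (insert a A) w * (1 - fps_X ^ w a)"
proof (rule fps_ext)
  fix n
  show "fps_nth (weighted_gf A w) n = fps_nth (weighted_gf (insert a A) w * (1 - fps_X ^ w a)) n"
    using card_weighted_funs_insert[OF assms, where n = n]
    by (simp add: weighted_gf_def right_diff_distrib fps_X_power_mult_right_nth)
qed

text \<open>The series is a product of factors 1/(1-X) and 1/(1-X^2), whose logarithmic derivatives
  are (1+X)/(1-X^2) and 2X/(1-X^2). The induction inserts one factor at a time, so the product
  itself is never formed.\<close>

lemma weighted_gf_deriv:
  assumes "finite A" "\<And>a. a \<in> A \<Longrightarrow> w a = 1 \<or> w a = 2"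
  shows "(1 - fps_X ^ 2) * fps_deriv (weighted_gf A w) =
    (of_nat (card {a \<in> A. w a = 1}) * (1 + fps_X) + of_nat (card {a \<in> A. w a = 2}) * (2 * fps_X)) * weighted_gf A w"
  using assms
proof (induction A rule: finite_induct)
  case empty
  have zero: "{f :: 'a \<Rightarrow> nat. \<forall>a. f a = 0} = {\<lambda>_. 0}"
    by auto
  have "weighted_gf {} w = 1"
    unfolding weighted_gf_def weighted_funs_def
    by (rule fps_ext) (simp add: zero flip: fun_eq_iff)
  then show ?case by simp
next
  case (insert a A)
  define S T where "S = weighted_gf (insert a A) w" and "T = weighted_gf A w"
  define \<rho> where "\<rho> = (of_nat (card {b \<in> A. w b = 1}) * (1 + fps_X) + of_nat (card {b \<in> A. w b = 2}) * (2 * fps_X) :: int fps)"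
  have pos: "0 < w b" if "b \<in> insert a A" for b
    using insert.prems[OF that] by auto
  have T: "T = S * (1 - fps_X ^ w a)"
    unfolding S_def T_def using insert.hyps pos by (intro weighted_gf_insert)
  have IH: "(1 - fps_X ^ 2) * fps_deriv T = \<rho> * T"
    unfolding T_def \<rho>_def using insert.prems by (intro insert.IH) auto
  have cards: "{b \<in> insert a A. w b = 1} = (if w a = 1 then insert a {b \<in> A. w b = 1} else {b \<in> A. w b = 1})"
    "{b \<in> insert a A. w b = 2} = (if w a = 2 then insert a {b \<in> A. w b = 2} else {b \<in> A. w b = 2})"
    by auto
  consider "w a = 1" | "w a = 2" using insert.prems by auto
  then show ?case
  proof cases
    case 1
    have nz: "(1 - fps_X :: int fps) \<noteq> 0"
      by (metis fps_X_neq_one right_minus_eq)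
    \<comment> \<open>Differentiating T = S (1 - X) gives (1 - X) S' = T' + S. The factor 1 - X is
      cancelled at the end, integer power series having no zero divisors.\<close>
    have "(1 - fps_X) * ((1 - fps_X ^ 2) * fps_deriv S) = (1 - fps_X ^ 2) * (fps_deriv T + S)"
      by (simp add: T 1 algebra_simps)
    also have "\<dots> = (1 - fps_X) * ((\<rho> + (1 + fps_X)) * S)"
      unfolding distrib_left IH by (simp add: T 1 algebra_simps power2_eq_square)
    finally have "(1 - fps_X ^ 2) * fps_deriv S = (\<rho> + (1 + fps_X)) * S"
      using nz by simp
    then show ?thesis
      using insert.hyps 1 unfolding cards S_def[symmetric] by (simp add: \<rho>_def algebra_simps)
  next
    case 2
    have nz: "(1 - fps_X ^ 2 :: int fps) \<noteq> 0"
    proof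
      assume "(1 - fps_X ^ 2 :: int fps) = 0"
      then have "(1 :: int fps) = fps_X ^ 2" by (simp only: right_minus_eq)
      then have "fps_nth (1 :: int fps) 0 = fps_nth (fps_X ^ 2) 0" by (rule arg_cong)
      then show False by (simp add: fps_X_power_nth)
    qed
    have dX2: "fps_deriv (fps_X ^ 2 :: int fps) = 2 * fps_X"
      by (simp add: power2_eq_square)
    have "(1 - fps_X ^ 2) * ((1 - fps_X ^ 2) * fps_deriv S) = (1 - fps_X ^ 2) * (fps_deriv T + 2 * fps_X * S)"
      by (simp add: T 2 dX2 algebra_simps)
    also have "\<dots> = (1 - fps_X ^ 2) * ((\<rho> + 2 * fps_X) * S)"
      unfolding distrib_left IH by (simp add: T 2 algebra_simps)
    finally have "(1 - fps_X ^ 2) * fps_deriv S = (\<rho> + 2 * fps_X) * S"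
      using nz by simp
    then show ?thesis
      using insert.hyps 2 unfolding cards S_def[symmetric] by (simp add: \<rho>_def algebra_simps)
  qed
qed

section \<open>Symmetric matrices as functions on the cells on or above the diagonal\<close>

definition sym_matrices :: "nat \<Rightarrow> nat \<Rightarrow> (nat \<times> nat \<Rightarrow> nat) set" where
  "sym_matrices R n = {M. (\<forall>x y. \<not> (x < R \<and> y < R) \<longrightarrow> M (x, y) = 0) \<and> (\<forall>x y. M (x, y) = M (y, x))
     \<and> sum M ({..<R} \<times> {..<R}) = n}"

definition upper_cells :: "nat \<Rightarrow> (nat \<times> nat) set" where
  "upper_cells R = {(x, y). x \<le> y \<and> y < R}"

text \<open>An off-diagonal cell stands for two equal entries, so it counts twice in the entry
  sum.\<close>

definition cell_weight :: "nat \<times> nat \<Rightarrow> nat" where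
  "cell_weight = (\<lambda>(x, y). if x = y then 1 else 2)"

lemma finite_upper_cells: "finite (upper_cells R)"
  by (rule finite_subset[of _ "{..<R} \<times> {..<R}"]) (auto simp: upper_cells_def)

lemma square_cells_sum:
  fixes M :: "nat \<times> nat \<Rightarrow> 'a :: comm_semiring_1"
  assumes "\<And>x y. M (x, y) = M (y, x)"
  shows "sum M ({..<R} \<times> {..<R}) = (\<Sum>a\<in>upper_cells R. of_nat (cell_weight a) * M a)"
proof -
  let ?D = "{a \<in> upper_cells R. fst a = snd a}" and ?U = "{a \<in> upper_cells R. fst a \<noteq> snd a}"
  have fin: "finite ?D" "finite ?U" using finite_upper_cells by auto
  have "{..<R} \<times> {..<R} = ?D \<union> ?U \<union> prod.swap ` ?U"
    by (force simp: upper_cells_def image_iff)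
  moreover have "sum M (prod.swap ` ?U) = sum M ?U"
    using assms by (subst sum.reindex) (auto simp: inj_on_def intro!: sum.cong)
  moreover have "(?D \<union> ?U) \<inter> prod.swap ` ?U = {}" "?D \<inter> ?U = {}"
    by (auto simp: upper_cells_def)
  ultimately have "sum M ({..<R} \<times> {..<R}) = sum M ?D + sum M ?U + sum M ?U"
    using fin by (simp add: sum.union_disjoint)
  also have "\<dots> = (\<Sum>a\<in>?D. of_nat (cell_weight a) * M a) + (\<Sum>a\<in>?U. of_nat (cell_weight a) * M a)"
    by (simp add: cell_weight_def case_prod_beta mult_2 sum.distrib add.assoc)
  also have "\<dots> = (\<Sum>a\<in>?D \<union> ?U. of_nat (cell_weight a) * M a)"
    using fin by (intro sum.union_disjoint[symmetric]) auto
  also have "?D \<union> ?U = upper_cells R" by auto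
  finally show ?thesis .
qed

lemma card_sym_matrices: "card (sym_matrices R n) = card (weighted_funs (upper_cells R) cell_weight n)"
proof -
  define ext :: "(nat \<times> nat \<Rightarrow> nat) \<Rightarrow> nat \<times> nat \<Rightarrow> nat"
    where "ext f = (\<lambda>(x, y). f (min x y, max x y))" for f
  define res :: "(nat \<times> nat \<Rightarrow> nat) \<Rightarrow> nat \<times> nat \<Rightarrow> nat"
    where "res M = (\<lambda>a. if a \<in> upper_cells R then M a else 0)" for M
  have ext_sum: "sum (ext f) ({..<R} \<times> {..<R}) = (\<Sum>a\<in>upper_cells R. cell_weight a * f a)" for f
  proof -
    have "sum (ext f) ({..<R} \<times> {..<R}) = (\<Sum>a\<in>upper_cells R. cell_weight a * ext f a)"
      by (subst square_cells_sum) (auto simp: ext_def min.commute max.commute)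
    also have "\<dots> = (\<Sum>a\<in>upper_cells R. cell_weight a * f a)"
      by (intro sum.cong) (auto simp: ext_def upper_cells_def)
    finally show ?thesis .
  qed
  have "bij_betw res (sym_matrices R n) (weighted_funs (upper_cells R) cell_weight n)"
  proof (rule bij_betw_byWitness[where f' = ext])
    show "\<forall>M\<in>sym_matrices R n. ext (res M) = M"
      by (auto simp: sym_matrices_def ext_def res_def upper_cells_def fun_eq_iff min_def max_def)
    show "\<forall>f\<in>weighted_funs (upper_cells R) cell_weight n. res (ext f) = f"
      by (auto simp: weighted_funs_def ext_def res_def upper_cells_def fun_eq_iff min_def max_def)
    show "ext ` weighted_funs (upper_cells R) cell_weight n \<subseteq> sym_matrices R n"
      by (auto simp: weighted_funs_def sym_matrices_def ext_sum)
         (auto simp: ext_def upper_cells_def min_def max_def)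
    show "res ` sym_matrices R n \<subseteq> weighted_funs (upper_cells R) cell_weight n"
      by (auto simp: weighted_funs_def sym_matrices_def square_cells_sum res_def)
  qed
  then show ?thesis by (rule bij_betw_same_card)
qed

lemma card_sym_matrices_recurrence:
  "(int n + 2) * int (card (sym_matrices R (n + 2))) =
     int R * int (card (sym_matrices R (n + 1))) + ((int R)\<^sup>2 + int n) * int (card (sym_matrices R n))"
proof -
  define S where "S = weighted_gf (upper_cells R) cell_weight"
  have S: "fps_nth S m = int (card (sym_matrices R m))" for m
    by (simp add: S_def weighted_gf_def card_sym_matrices)
  have diag: "card {a \<in> upper_cells R. cell_weight a = 1} = R"
  proof -
    have "{a \<in> upper_cells R. cell_weight a = 1} = (\<lambda>x. (x, x)) ` {..<R}"
      by (auto simp: upper_cells_def cell_weight_def split: if_splits)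
    then show ?thesis by (simp add: card_image inj_on_def)
  qed
  \<comment> \<open>The all-ones matrix counts the cells: R^2 is R plus twice the number of cells of
    weight 2.\<close>
  have "int (R * R) = (\<Sum>a\<in>upper_cells R. of_nat (cell_weight a) * 1)"
    using square_cells_sum[of "\<lambda>_. 1 :: int" R] by simp
  also have "upper_cells R = {a \<in> upper_cells R. cell_weight a = 1} \<union> {a \<in> upper_cells R. cell_weight a = 2}"
    by (auto simp: cell_weight_def split: if_splits)
  also have "(\<Sum>a\<in>\<dots>. of_nat (cell_weight a) * 1) = int R + 2 * int (card {a \<in> upper_cells R. cell_weight a = 2})"
    by (subst sum.union_disjoint) (auto simp: finite_upper_cells diag[simplified])
  finally have off: "2 * int (card {a \<in> upper_cells R. cell_weight a = 2}) = int (R * R) - int R" by simp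
  have off': "of_nat (card {a \<in> upper_cells R. cell_weight a = 2}) * (2 * fps_X)
      = (of_nat R * of_nat R - of_nat R) * (fps_X :: int fps)"
    using arg_cong[OF off, of "\<lambda>z. of_int z * (fps_X :: int fps)"] by (simp add: algebra_simps)
  have w12: "cell_weight a = 1 \<or> cell_weight a = 2" for a
    by (simp add: cell_weight_def split: prod.split)
  \<comment> \<open>The two kinds of cells contribute R (1 + X) and (R^2 - R) X, which collapse to R
    + R^2 X.\<close>
  have "(1 - fps_X ^ 2) * fps_deriv S = (of_nat R + of_nat R * of_nat R * fps_X) * S"
    using weighted_gf_deriv[OF finite_upper_cells, of R cell_weight, OF w12] unfolding diag off' S_def[symmetric]
    by (simp add: algebra_simps)
  then have "fps_nth ((1 - fps_X ^ 2) * fps_deriv S) (n + 1) = fps_nth ((of_nat R + of_nat R * of_nat R * fps_X) * S) (n + 1)"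
    by simp
  moreover have "fps_nth ((1 - fps_X ^ 2) * fps_deriv S) (n + 1) = (int n + 2) * fps_nth S (n + 2) - int n * fps_nth S n"
    by (cases n) (simp_all add: left_diff_distrib fps_X_power_mult_nth)
  moreover have "fps_nth ((of_nat R + of_nat R * of_nat R * fps_X) * S) (n + 1) = int R * fps_nth S (n + 1) + int R * int R * fps_nth S n"
    by (simp add: distrib_right mult.assoc fps_mult_of_nat_nth)
  ultimately show ?thesis
    by (simp add: S algebra_simps power2_eq_square)
qed

subsection \<open>Labelled involutions\<close>

text \<open>Values outside \<open>{1..n}\<close> are pinned to 0, so that a word of length
  \<open>n\<close> is a single function.\<close>

definition monotone_seqs :: "nat \<Rightarrow> nat set \<Rightarrow> nat \<Rightarrow> (nat \<Rightarrow> nat) set" where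
  "monotone_seqs n D R = {c. (\<forall>i. i \<notin> {1..n} \<longrightarrow> c i = 0) \<and> (\<forall>i\<in>{1..n}. c i < R) \<and>
     (\<forall>i\<in>{1..<n}. c i \<le> c (i + 1) \<and> (i \<in> D \<longrightarrow> c i < c (i + 1)))}"

lemma finite_monotone_seqs: "finite (monotone_seqs n D R)"
proof (rule finite_subset)
  show "monotone_seqs n D R \<subseteq> {c. \<forall>i. (i \<in> {1..n} \<longrightarrow> c i \<in> {..<R}) \<and> (i \<notin> {1..n} \<longrightarrow> c i = 0)}"
    by (auto simp: monotone_seqs_def)
qed (intro finite_set_of_finite_funs, simp_all)

text \<open>Words are split by whether their last letter is the largest one, \<open>R\<close>.
  Removing a final \<open>R\<close> leaves a word that may still use \<open>R\<close>, unless
  position \<open>n\<close> demands a strict increase. For \<open>n = 0\<close> there is no such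
  position, hence the condition \<open>1 \<le> n\<close>.\<close>

lemma card_monotone_seqs_Suc_Suc:
  "card (monotone_seqs (Suc n) D (Suc R)) = card (monotone_seqs (Suc n) D R)
     + card (monotone_seqs n D (if n \<in> D \<and> 1 \<le> n then R else Suc R))"
proof -
  let ?R = "if n \<in> D \<and> 1 \<le> n then R else Suc R"
  let ?T = "{c \<in> monotone_seqs (Suc n) D (Suc R). c (Suc n) = R}"
  have le_last: "c i \<le> c (Suc n)" if "\<forall>i\<in>{1..<Suc n}. c i \<le> c (i + 1)" "1 \<le> i" "i \<le> Suc n" for c :: "nat \<Rightarrow> nat" and i
    using that(3) that(2)
    by (induction rule: inc_induct) (use that(1) in \<open>auto intro: order.trans\<close>)
  have split: "monotone_seqs (Suc n) D (Suc R) = monotone_seqs (Suc n) D R \<union> ?T"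
  proof (intro equalityI subsetI)
    fix c assume c: "c \<in> monotone_seqs (Suc n) D (Suc R)"
    then have "c i \<le> c (Suc n)" if "1 \<le> i" "i \<le> Suc n" for i
      using le_last[of c i] that by (auto simp: monotone_seqs_def)
    moreover have "c (Suc n) \<le> R" using c by (auto simp: monotone_seqs_def less_Suc_eq_le)
    ultimately show "c \<in> monotone_seqs (Suc n) D R \<union> ?T"
      using c by (cases "c (Suc n) = R") (force simp: monotone_seqs_def)+
  qed (auto simp: monotone_seqs_def less_Suc_eq)
  have "bij_betw (\<lambda>c. c(Suc n := 0)) ?T (monotone_seqs n D ?R)"
  proof (rule bij_betw_byWitness[where f' = "\<lambda>c. c(Suc n := R)"])
    show "(\<lambda>c. c(Suc n := 0)) ` ?T \<subseteq> monotone_seqs n D ?R"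
    proof (rule image_subsetI)
      fix c assume "c \<in> ?T"
      then have c: "c \<in> monotone_seqs (Suc n) D (Suc R)" "c (Suc n) = R" by auto
      have "c i \<le> c n" if "1 \<le> i" "i \<le> n" for i
        using that(2,1) c(1) by (induction rule: inc_induct) (auto simp: monotone_seqs_def intro: order.trans)
      moreover have "c n < ?R" if "1 \<le> n"
        using c that by (force simp: monotone_seqs_def)
      ultimately have "c i < ?R" if "1 \<le> i" "i \<le> n" for i
        using that by (meson le_less_trans le_trans)
      then show "c(Suc n := 0) \<in> monotone_seqs n D ?R"
        using c by (auto simp: monotone_seqs_def)
    qed
    show "(\<lambda>c. c(Suc n := R)) ` monotone_seqs n D ?R \<subseteq> ?T"
    proof (rule image_subsetI)
      fix c assume c: "c \<in> monotone_seqs n D ?R"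
      have "c n < ?R" if "1 \<le> n"
        using c that by (auto simp: monotone_seqs_def)
      then have "c n \<le> R" "n \<in> D \<Longrightarrow> c n < R" if "1 \<le> n"
        using that by (auto split: if_splits)
      moreover have "c i < Suc R" if "1 \<le> i" "i \<le> n" for i
        using c that by (auto simp: monotone_seqs_def less_Suc_eq split: if_splits)
      ultimately show "c(Suc n := R) \<in> ?T"
        using c by (auto simp: monotone_seqs_def less_Suc_eq[of _ n] le_Suc_eq)
    qed
  qed (auto simp: monotone_seqs_def)
  then have "card ?T = card (monotone_seqs n D ?R)"
    by (rule bij_betw_same_card)
  moreover have "monotone_seqs (Suc n) D R \<inter> ?T = {}"
    by (auto simp: monotone_seqs_def)
  moreover have "finite ?T" using finite_monotone_seqs by auto
  ultimately show ?thesis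
    by (subst split) (simp only: card_Un_disjoint finite_monotone_seqs)
qed

text \<open>The splitting by the last letter is Pascal's rule: the number of strict positions grows
  by one exactly when the alphabet of the shortened word shrinks by one.\<close>

lemma card_monotone_seqs:
  "card (monotone_seqs n D R) = (n + R - 1 - card (D \<inter> {1..<n})) choose n"
proof (induction n arbitrary: R)
  case 0
  have "monotone_seqs 0 D R = {\<lambda>_. 0}" by (auto simp: monotone_seqs_def)
  then show ?case by simp
next
  case (Suc n)
  show ?case
  proof (induction R)
    case 0
    have "monotone_seqs (Suc n) D 0 = {}" by (auto simp: monotone_seqs_def)
    then show ?case by simp
  next
    case (Suc R)
    let ?d = "card (D \<inter> {1..<Suc n})"
    have d: "?d = card (D \<inter> {1..<n}) + (if n \<in> D \<and> 1 \<le> n then 1 else 0)"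
    proof -
      have "D \<inter> {1..<Suc n} = (if n \<in> D \<and> 1 \<le> n then insert n (D \<inter> {1..<n}) else D \<inter> {1..<n})"
        by (auto simp: less_Suc_eq)
      then show ?thesis by simp
    qed
    have "?d \<le> card {1..<Suc n}" by (intro card_mono) auto
    then have le: "?d \<le> n" by simp
    have "card (monotone_seqs n D (if n \<in> D \<and> 1 \<le> n then R else Suc R)) = (n + R - ?d) choose n"
      unfolding \<open>\<And>R. card (monotone_seqs n D R) = (n + R - 1 - card (D \<inter> {1..<n})) choose n\<close> d by simp
    moreover have "Suc n + Suc R - 1 - ?d = Suc (n + R - ?d)" "Suc n + R - 1 - ?d = n + R - ?d"
      using le by simp_all
    ultimately show ?case
      by (simp only: card_monotone_seqs_Suc_Suc Suc.IH binomial_Suc_Suc add.commute)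
  qed
qed

section \<open>Sorted enumerations and ranks\<close>

lemma ex_enumeration:
  fixes S :: "'a :: linorder set"
  assumes "finite S"
  shows "\<exists>\<phi>. bij_betw \<phi> {1..card S} S \<and> (\<forall>i\<in>{1..card S}. \<forall>j\<in>{1..card S}. i < j \<longrightarrow> \<phi> i < \<phi> j)"
proof -
  define xs where "xs = sorted_list_of_set S"
  have xs: "set xs = S" "length xs = card S" "distinct xs" "sorted_wrt (<) xs"
    using assms by (simp_all add: xs_def)
  have "bij_betw (\<lambda>i. i - 1) {1..card S} {..<card S}"
    by (rule bij_betw_byWitness[where f' = Suc]) auto
  moreover have "bij_betw (nth xs) {..<card S} S"
    using bij_betw_nth[OF xs(3)] xs(1,2) by simp
  ultimately have "bij_betw (nth xs \<circ> (\<lambda>i. i - 1)) {1..card S} S"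
    by (rule bij_betw_trans)
  moreover have "(nth xs \<circ> (\<lambda>i. i - 1)) i < (nth xs \<circ> (\<lambda>i. i - 1)) j"
    if "i \<in> {1..card S}" "j \<in> {1..card S}" "i < j" for i j
    using that xs(2,4) by (auto simp: sorted_wrt_iff_nth_less)
  ultimately show ?thesis by blast
qed

text \<open>A weakly increasing word is the sorted arrangement of its multiset of letters. It serves
  to rebuild a word of pairs from a matrix of multiplicities.\<close>

lemma sorted_seq_eqI:
  fixes f g :: "nat \<Rightarrow> 'a :: linorder"
  assumes mono: "\<And>i. i \<in> {1..<n} \<Longrightarrow> f i \<le> f (i + 1)" "\<And>i. i \<in> {1..<n} \<Longrightarrow> g i \<le> g (i + 1)"
    and card: "\<And>v. card {i \<in> {1..n}. f i = v} = card {i \<in> {1..n}. g i = v}"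
    and i: "i \<in> {1..n}"
  shows "f i = g i"
proof -
  have sorted: "sorted (map h [1..<Suc n])" if "\<And>i. i \<in> {1..<n} \<Longrightarrow> h i \<le> h (i + 1)" for h :: "nat \<Rightarrow> 'a"
    using that by (auto simp: sorted_iff_nth_Suc simp del: upt_Suc)
  have count: "count (mset (map h [1..<Suc n])) v = card {i \<in> {1..n}. h i = v}" for h :: "nat \<Rightarrow> 'a" and v
  proof -
    have "count (mset (map h js)) v = length (filter (\<lambda>i. h i = v) js)" for js
      by (induction js) auto
    then have "count (mset (map h [1..<Suc n])) v = length (filter (\<lambda>i. h i = v) [1..<Suc n])"
      by blast
    also have "\<dots> = card {i \<in> {1..n}. h i = v}"
      by (subst distinct_card[symmetric]) (auto simp: simp del: upt_Suc intro!: arg_cong[of _ _ card])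
    finally show ?thesis .
  qed
  have "mset (map f [1..<Suc n]) = mset (map g [1..<Suc n])"
    by (rule multiset_eqI) (simp only: count card)
  then have "map f [1..<Suc n] = map g [1..<Suc n]"
    using sorted[of f, OF mono(1)] sorted[of g, OF mono(2)] by (metis properties_for_sort)
  then show ?thesis using i by (simp del: upt_Suc)
qed

text \<open>This recovers a permutation from the mere comparisons between its values.\<close>

lemma permutes_eq_rank:
  assumes "\<pi> permutes {1..n}" "i \<in> {1..n}"
  shows "\<pi> i = card {j \<in> {1..n}. \<pi> j \<le> \<pi> i}"
proof -
  have "\<pi> ` {j \<in> {1..n}. \<pi> j \<le> \<pi> i} = {1..\<pi> i}"
  proof (intro equalityI subsetI)
    fix k assume "k \<in> {1..\<pi> i}"
    moreover have "\<pi> i \<le> n" using permutes_in_image[OF assms(1)] assms(2) by (metis atLeastAtMost_iff)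
    ultimately have "k \<in> \<pi> ` {1..n}" using permutes_image[OF assms(1)] by auto
    then show "k \<in> \<pi> ` {j \<in> {1..n}. \<pi> j \<le> \<pi> i}" using \<open>k \<in> {1..\<pi> i}\<close> by auto
  next
    fix k assume "k \<in> \<pi> ` {j \<in> {1..n}. \<pi> j \<le> \<pi> i}"
    then obtain j where "j \<in> {1..n}" "k = \<pi> j" "\<pi> j \<le> \<pi> i" by auto
    then show "k \<in> {1..\<pi> i}" using permutes_in_image[OF assms(1), of j] by auto
  qed
  moreover have "inj_on \<pi> {j \<in> {1..n}. \<pi> j \<le> \<pi> i}"
    using permutes_inj[OF assms(1)] by (auto simp: inj_on_def)
  ultimately show ?thesis by (metis card_atLeastAtMost card_image diff_Suc_1)
qed

section \<open>The bijection between labelled involutions and symmetric matrices\<close>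

definition labelled_involutions :: "nat \<Rightarrow> nat \<Rightarrow> ((nat \<Rightarrow> nat) \<times> (nat \<Rightarrow> nat)) set" where
  "labelled_involutions n R = (SIGMA \<pi>:involutions n. monotone_seqs n (DES n \<pi>) R)"

definition label_matrix :: "nat \<Rightarrow> (nat \<Rightarrow> nat) \<times> (nat \<Rightarrow> nat) \<Rightarrow> nat \<times> nat \<Rightarrow> nat" where
  "label_matrix n = (\<lambda>(\<pi>, c) v. card {i \<in> {1..n}. (c i, c (\<pi> i)) = v})"

context
  fixes n R \<pi> c
  assumes lab: "(\<pi>, c) \<in> labelled_involutions n R"
begin

lemma lab_permutes: "\<pi> permutes {1..n}"
  and lab_involution: "\<pi> (\<pi> i) = i"
  and lab_range: "i \<in> {1..n} \<Longrightarrow> c i < R"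
  and lab_outside: "i \<notin> {1..n} \<Longrightarrow> c i = 0"
  and lab_step: "i \<in> {1..<n} \<Longrightarrow> c i \<le> c (i + 1)"
  and lab_descent: "i \<in> {1..<n} \<Longrightarrow> \<pi> i > \<pi> (i + 1) \<Longrightarrow> c i < c (i + 1)"
  using lab by (auto simp: labelled_involutions_def involutions_def monotone_seqs_def DES_def fun_eq_iff)

lemma lab_in: "i \<in> {1..n} \<Longrightarrow> \<pi> i \<in> {1..n}"
  using permutes_in_image[OF lab_permutes] by blast

lemma lab_mono:
  assumes "1 \<le> i" "i \<le> j" "j \<le> n"
  shows "c i \<le> c j"
  using assms(2,3)
proof (induction rule: dec_induct)
  case (step k)
  then show ?case using lab_step[of k] assms(1) by simp
qed simp

text \<open>Letters between two equal letters are equal to them, and a descent there would force a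
  strict increase.\<close>

lemma lab_increasing_on_level:
  assumes "1 \<le> i" "i < j" "j \<le> n" "c i = c j"
  shows "\<pi> i < \<pi> j"
proof -
  have "\<pi> k < \<pi> (k + 1)" if "i \<le> k" "k < j" for k
  proof -
    have "c i \<le> c k" "c k \<le> c (k + 1)" "c (k + 1) \<le> c j"
      using that assms(1-3) by (auto intro!: lab_mono)
    then have "\<not> \<pi> k > \<pi> (k + 1)" using lab_descent[of k] assms that by auto
    moreover have "\<pi> k \<noteq> \<pi> (k + 1)" using inj_eq[OF permutes_inj[OF lab_permutes]] by simp
    ultimately show ?thesis by simp
  qed
  note step = this
  have "Suc i \<le> j" using assms(2) by simp
  then have "j \<le> j \<longrightarrow> \<pi> i < \<pi> j"
  proof (induction rule: dec_induct)
    case base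
    then show ?case using step[of i] assms by simp
  next
    case (step k)
    then show ?case using \<open>\<And>k. i \<le> k \<Longrightarrow> k < j \<Longrightarrow> \<pi> k < \<pi> (k + 1)\<close>[of k] by auto
  qed
  then show ?thesis by simp
qed

text \<open>Since \<open>\<pi>\<close> is an involution, \<open>i\<close> and \<open>j\<close> are
  the images of the positions \<open>\<pi> i\<close> and \<open>\<pi> j\<close>; if these carry
  equal letters, \<open>lab_increasing_on_level\<close> applies to them. So the pairs
  \<open>(c i, c (\<pi> i))\<close> alone determine the order of the values of
  \<open>\<pi>\<close>.\<close>

lemma lab_le_iff:
  assumes "i \<in> {1..n}" "j \<in> {1..n}"
  shows "\<pi> j \<le> \<pi> i \<longleftrightarrow> c (\<pi> j) < c (\<pi> i) \<or> c (\<pi> j) = c (\<pi> i) \<and> j \<le> i"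
proof -
  have in': "\<pi> i \<in> {1..n}" "\<pi> j \<in> {1..n}" using assms lab_in by blast+
  have eq: "j \<le> i \<longleftrightarrow> \<pi> j \<le> \<pi> i" if "c (\<pi> j) = c (\<pi> i)"
    using lab_increasing_on_level[of "\<pi> i" "\<pi> j"] lab_increasing_on_level[of "\<pi> j" "\<pi> i"] in' that
    by (metis atLeastAtMost_iff lab_involution le_less linorder_not_le)
  have le: "c (\<pi> j) \<le> c (\<pi> i)" if "\<pi> j \<le> \<pi> i"
    using lab_mono[of "\<pi> j" "\<pi> i"] in' that by simp
  have ge: "c (\<pi> i) \<le> c (\<pi> j)" if "\<pi> i \<le> \<pi> j"
    using lab_mono[of "\<pi> i" "\<pi> j"] in' that by simp
  show ?thesis
  proof (cases "c (\<pi> j) = c (\<pi> i)")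
    case True
    then show ?thesis using eq by simp
  next
    case False
    then show ?thesis using le ge by (cases "\<pi> j \<le> \<pi> i") auto
  qed
qed

text \<open>Being sorted, the word of pairs is determined by its multiset, which is what
  \<open>label_matrix\<close> records.\<close>

lemma lab_pairs_step:
  assumes "i \<in> {1..<n}"
  shows "(c i, c (\<pi> i)) \<le> (c (i + 1), c (\<pi> (i + 1)))"
proof (cases "c i = c (i + 1)")
  case True
  then have "\<pi> i < \<pi> (i + 1)" using lab_increasing_on_level[of i "i + 1"] assms by simp
  then have "c (\<pi> i) \<le> c (\<pi> (i + 1))"
    using lab_in[of i] lab_in[of "i + 1"] assms by (intro lab_mono) auto
  then show ?thesis using True by simp
next
  case False
  then show ?thesis using lab_step[OF assms] by simp
qed

lemma label_matrix_sym: "label_matrix n (\<pi>, c) \<in> sym_matrices R n"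
proof -
  let ?M = "label_matrix n (\<pi>, c)"
  have "?M (x, y) = ?M (y, x)" for x y
  proof -
    have "bij_betw \<pi> {i \<in> {1..n}. (c i, c (\<pi> i)) = (x, y)} {i \<in> {1..n}. (c i, c (\<pi> i)) = (y, x)}"
      by (rule bij_betw_byWitness[where f' = \<pi>]) (use lab_in lab_involution in auto)
    then show ?thesis by (simp add: label_matrix_def bij_betw_same_card)
  qed
  moreover have "?M (x, y) = 0" if "\<not> (x < R \<and> y < R)" for x y
  proof -
    have "{i \<in> {1..n}. (c i, c (\<pi> i)) = (x, y)} = {}"
      using that lab_range lab_range[OF lab_in] by auto
    then show ?thesis by (simp only: label_matrix_def prod.case card.empty)
  qed
  moreover have "sum ?M ({..<R} \<times> {..<R}) = n"
  proof -
    have "sum ?M ({..<R} \<times> {..<R}) = (\<Sum>v\<in>{..<R} \<times> {..<R}. \<Sum>i | i \<in> {1..n} \<and> (c i, c (\<pi> i)) = v. 1)"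
      by (simp add: label_matrix_def)
    also have "\<dots> = (\<Sum>i\<in>{1..n}. 1)"
      by (rule sum.group) (use lab_range lab_in in auto)
    finally show ?thesis by simp
  qed
  ultimately show ?thesis by (simp add: sym_matrices_def)
qed

end

text \<open>Equal matrices give equal sorted words of pairs. Their first components are
  \<open>c\<close>, and by \<open>lab_le_iff\<close> the pairs fix the rank of each
  \<open>\<pi> i\<close>, hence \<open>\<pi>\<close>.\<close>

lemma label_matrix_inj:
  assumes a: "(\<pi>, c) \<in> labelled_involutions n R" and b: "(\<pi>', c') \<in> labelled_involutions n R"
    and eq: "label_matrix n (\<pi>, c) = label_matrix n (\<pi>', c')"
  shows "\<pi> = \<pi>' \<and> c = c'"
proof -
  have pairs: "(c i, c (\<pi> i)) = (c' i, c' (\<pi>' i))" if "i \<in> {1..n}" for i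
    by (rule sorted_seq_eqI[of n "\<lambda>i. (c i, c (\<pi> i))" "\<lambda>i. (c' i, c' (\<pi>' i))"])
      (use that lab_pairs_step[OF a] lab_pairs_step[OF b] fun_cong[OF eq] in \<open>auto simp: label_matrix_def\<close>)
  then have "c = c'"
    using lab_outside[OF a] lab_outside[OF b] by (metis ext prod.inject)
  moreover have "\<pi> i = \<pi>' i" for i
  proof (cases "i \<in> {1..n}")
    case True
    have "\<pi> j \<le> \<pi> i \<longleftrightarrow> \<pi>' j \<le> \<pi>' i" if "j \<in> {1..n}" for j
      using lab_le_iff[OF a True that] lab_le_iff[OF b True that] pairs[OF True] pairs[OF that] by simp
    then have "{j \<in> {1..n}. \<pi> j \<le> \<pi> i} = {j \<in> {1..n}. \<pi>' j \<le> \<pi>' i}" by blast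
    then show ?thesis
      using permutes_eq_rank[OF lab_permutes[OF a] True] permutes_eq_rank[OF lab_permutes[OF b] True] by simp
  next
    case False
    then show ?thesis using permutes_not_in[OF lab_permutes[OF a]] permutes_not_in[OF lab_permutes[OF b]] by metis
  qed
  ultimately show ?thesis by auto
qed

text \<open>List the cells \<open>(x, y)\<close> with multiplicity \<open>M (x, y)\<close> in lexicographic order. Transposing cells
  while keeping the copy index is an involution of the list positions.\<close>

lemma label_matrix_surj:
  assumes M: "M \<in> sym_matrices R n"
  shows "\<exists>p\<in>labelled_involutions n R. label_matrix n p = M"
proof -
  define S where "S = (SIGMA x:{..<R}. SIGMA y:{..<R}. {..<M (x, y)})"
  have finS: "finite S" by (auto simp: S_def)
  have "card S = sum M ({..<R} \<times> {..<R})"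
    by (simp add: S_def sum.cartesian_product)
  then have cardS: "card S = n" using M by (simp add: sym_matrices_def)
  have in_S: "(x, y, j) \<in> S \<longleftrightarrow> j < M (x, y)" for x y j
  proof -
    have "x < R \<and> y < R" if "j < M (x, y)"
    proof (rule ccontr)
      assume "\<not> (x < R \<and> y < R)"
      then have "M (x, y) = 0" using M unfolding sym_matrices_def by blast
      then show False using that by simp
    qed
    then show ?thesis by (auto simp: S_def)
  qed
  have sym: "M (x, y) = M (y, x)" for x y using M unfolding sym_matrices_def by blast
  obtain \<phi> where bij: "bij_betw \<phi> {1..n} S"
    and mono: "\<And>i j. i \<in> {1..n} \<Longrightarrow> j \<in> {1..n} \<Longrightarrow> i < j \<Longrightarrow> \<phi> i < \<phi> j"
    using ex_enumeration[OF finS] cardS by auto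
  define \<psi> where "\<psi> = inv_into {1..n} \<phi>"
  have \<psi>: "\<psi> s \<in> {1..n}" "\<phi> (\<psi> s) = s" if "s \<in> S" for s
    using that bij by (auto simp: \<psi>_def bij_betw_def inv_into_into f_inv_into_f)
  have \<phi>: "\<phi> i \<in> S" "\<psi> (\<phi> i) = i" if "i \<in> {1..n}" for i
    using that bij by (auto simp: \<psi>_def bij_betw_def inv_into_f_f)
  define \<tau> :: "nat \<times> nat \<times> nat \<Rightarrow> nat \<times> nat \<times> nat" where "\<tau> = (\<lambda>(x, y, j). (y, x, j))"
  have \<tau>: "\<tau> s \<in> S \<longleftrightarrow> s \<in> S" "\<tau> (\<tau> s) = s" for s
    by (cases s; simp add: \<tau>_def in_S sym)+
  define \<pi> where "\<pi> i = (if i \<in> {1..n} then \<psi> (\<tau> (\<phi> i)) else i)" for i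
  define c where "c i = (if i \<in> {1..n} then fst (\<phi> i) else 0)" for i
  have \<pi>_in: "\<pi> i \<in> {1..n}" if "i \<in> {1..n}" for i
    using \<psi>(1)[of "\<tau> (\<phi> i)"] \<phi>(1)[OF that] \<tau>(1) that unfolding \<pi>_def by simp
  have \<phi>\<pi>: "\<phi> (\<pi> i) = \<tau> (\<phi> i)" if "i \<in> {1..n}" for i
    using \<psi>(2)[of "\<tau> (\<phi> i)"] \<phi>(1)[OF that] \<tau>(1) that unfolding \<pi>_def by simp
  have \<pi>\<pi>: "\<pi> (\<pi> i) = i" for i
  proof (cases "i \<in> {1..n}")
    case True
    have "\<phi> (\<pi> (\<pi> i)) = \<phi> i"
      using \<phi>\<pi>[OF True] \<phi>\<pi>[OF \<pi>_in[OF True]] \<tau>(2) by simp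
    then show ?thesis using \<phi>(2)[OF True] \<phi>(2)[OF \<pi>_in[OF \<pi>_in[OF True]]] by simp
  qed (auto simp: \<pi>_def)
  have "\<pi> permutes {1..n}"
  proof (rule bij_imp_permutes)
    show "bij_betw \<pi> {1..n} {1..n}"
      by (rule bij_betw_byWitness[where f' = \<pi>]) (use \<pi>_in \<pi>\<pi> in auto)
  qed (auto simp: \<pi>_def)
  then have inv: "\<pi> \<in> involutions n"
    using \<pi>\<pi> by (simp add: involutions_def fun_eq_iff)
  have cpair: "(c i, c (\<pi> i)) = (fst (\<phi> i), fst (snd (\<phi> i)))" if "i \<in> {1..n}" for i
    using that \<pi>_in[OF that] \<phi>\<pi>[OF that] by (simp add: c_def \<tau>_def case_prod_beta)
  have c_range: "c i < R" if "i \<in> {1..n}" for i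
    using \<phi>(1)[OF that] that by (auto simp: c_def S_def)
  have step: "c i \<le> c (i + 1) \<and> (\<pi> i > \<pi> (i + 1) \<longrightarrow> c i < c (i + 1))" if "i \<in> {1..<n}" for i
  proof -
    have i: "i \<in> {1..n}" "i + 1 \<in> {1..n}" using that by auto
    obtain x y j where 1: "\<phi> i = (x, y, j)" by (metis prod.exhaust)
    obtain x' y' j' where 2: "\<phi> (i + 1) = (x', y', j')" by (metis prod.exhaust)
    have less: "(x, y, j) < (x', y', j')" using mono[OF i] 1 2 by simp
    have cs: "c i = x" "c (i + 1) = x'" using i 1 2 by (auto simp: c_def)
    have "\<pi> i < \<pi> (i + 1)" if "x = x'"
    proof -
      \<comment> \<open>For equal first coordinates the order is that of \<open>(y, j)\<close>, and
        it survives the move of the common \<open>x\<close> to the middle. This is why equal letters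
        never meet a descent.\<close>
      have "\<phi> (\<pi> i) < \<phi> (\<pi> (i + 1))"
        using less that unfolding \<phi>\<pi>[OF i(1)] \<phi>\<pi>[OF i(2)] 1 2 by (auto simp: \<tau>_def)
      then have "\<not> \<pi> (i + 1) \<le> \<pi> i"
        using mono[OF \<pi>_in[OF i(2)] \<pi>_in[OF i(1)]] by (metis le_less less_asym less_irrefl)
      then show ?thesis by simp
    qed
    have "x \<le> x'" using less by auto
    then show ?thesis
      unfolding cs using \<open>x = x' \<Longrightarrow> \<pi> i < \<pi> (i + 1)\<close> by linarith
  qed
  have "(\<pi>, c) \<in> labelled_involutions n R"
  proof -
    have "c i = 0" if "i \<notin> {1..n}" for i
      unfolding c_def using that by (rule if_not_P)
    then have "c \<in> monotone_seqs n (DES n \<pi>) R"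
      unfolding monotone_seqs_def mem_Collect_eq using step c_range by (simp add: DES_def)
    then show ?thesis using inv by (simp add: labelled_involutions_def)
  qed
  moreover have "label_matrix n (\<pi>, c) = M"
  proof
    fix v :: "nat \<times> nat"
    obtain x y where v: "v = (x, y)" by (cases v)
    have level: "\<exists>j. \<phi> i = (x, y, j)" if "i \<in> {i \<in> {1..n}. (c i, c (\<pi> i)) = (x, y)}" for i
      using that cpair[of i] by (cases "\<phi> i") auto
    have "bij_betw (\<lambda>i. snd (snd (\<phi> i))) {i \<in> {1..n}. (c i, c (\<pi> i)) = (x, y)} {..<M (x, y)}"
    proof (rule bij_betw_byWitness[where f' = "\<lambda>j. \<psi> (x, y, j)"])
      show "\<forall>i\<in>{i \<in> {1..n}. (c i, c (\<pi> i)) = (x, y)}. \<psi> (x, y, snd (snd (\<phi> i))) = i"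
      proof
        fix i assume i: "i \<in> {i \<in> {1..n}. (c i, c (\<pi> i)) = (x, y)}"
        then obtain j where "\<phi> i = (x, y, j)" using level by blast
        then show "\<psi> (x, y, snd (snd (\<phi> i))) = i" using \<phi>(2)[of i] i by simp
      qed
      show "\<forall>j\<in>{..<M (x, y)}. snd (snd (\<phi> (\<psi> (x, y, j)))) = j"
        using \<psi>(2) in_S by simp
      show "(\<lambda>i. snd (snd (\<phi> i))) ` {i \<in> {1..n}. (c i, c (\<pi> i)) = (x, y)} \<subseteq> {..<M (x, y)}"
      proof (rule image_subsetI)
        fix i assume i: "i \<in> {i \<in> {1..n}. (c i, c (\<pi> i)) = (x, y)}"
        then obtain j where "\<phi> i = (x, y, j)" using level by blast
        then show "snd (snd (\<phi> i)) \<in> {..<M (x, y)}" using \<phi>(1)[of i] in_S i by simp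
      qed
      show "(\<lambda>j. \<psi> (x, y, j)) ` {..<M (x, y)} \<subseteq> {i \<in> {1..n}. (c i, c (\<pi> i)) = (x, y)}"
      proof (rule image_subsetI)
        fix j assume "j \<in> {..<M (x, y)}"
        then have "(x, y, j) \<in> S" by (simp add: in_S)
        then show "\<psi> (x, y, j) \<in> {i \<in> {1..n}. (c i, c (\<pi> i)) = (x, y)}"
          using \<psi>[of "(x, y, j)"] cpair[of "\<psi> (x, y, j)"] by simp
      qed
    qed
    then show "label_matrix n (\<pi>, c) v = M v"
      by (simp add: label_matrix_def v bij_betw_same_card)
  qed
  ultimately show ?thesis by blast
qed

lemma finite_involutions: "finite (involutions n)"
  by (rule finite_subset[OF _ finite_permutations[of "{1..n}"]]) (auto simp: involutions_def)

lemma card_sym_matrices_eq_sum: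
  "card (sym_matrices R n) = (\<Sum>\<pi>\<in>involutions n. (n + R - 1 - des n \<pi>) choose n)"
proof -
  have "bij_betw (label_matrix n) (labelled_involutions n R) (sym_matrices R n)"
  proof (rule bij_betwI')
    fix p q assume "p \<in> labelled_involutions n R" "q \<in> labelled_involutions n R"
    then show "(label_matrix n p = label_matrix n q) = (p = q)"
      using label_matrix_inj by (cases p; cases q; blast)
  qed (use label_matrix_sym label_matrix_surj in \<open>auto, blast?\<close>)
  then have "card (sym_matrices R n) = card (labelled_involutions n R)"
    by (metis bij_betw_same_card)
  also have "\<dots> = (\<Sum>\<pi>\<in>involutions n. card (monotone_seqs n (DES n \<pi>) R))"
    by (simp add: labelled_involutions_def finite_involutions finite_monotone_seqs)
  also have "\<dots> = (\<Sum>\<pi>\<in>involutions n. (n + R - 1 - des n \<pi>) choose n)"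
  proof (rule sum.cong[OF refl])
    fix \<pi>
    have "DES n \<pi> \<inter> {1..<n} = DES n \<pi>" by (auto simp: DES_def)
    then show "card (monotone_seqs n (DES n \<pi>) R) = (n + R - 1 - des n \<pi>) choose n"
      by (simp add: card_monotone_seqs des_def)
  qed
  finally show ?thesis .
qed

subsection \<open>Gamma expansions\<close>

definition shift_seq :: "(nat \<Rightarrow> int) \<Rightarrow> nat \<Rightarrow> int" where
  "shift_seq c k = (case k of 0 \<Rightarrow> 0 | Suc j \<Rightarrow> c j)"

lemma shift_seq_simps [simp]:
  "shift_seq c 0 = 0" "shift_seq c (Suc j) = c j"
  by (simp_all add: shift_seq_def)

text \<open>The operator \<open>euler_lift (d + 1)\<close> in gamma coordinates, with the
  coefficient 2(d - 2j) re-indexed to \<open>k = j + 1\<close>.\<close>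

definition gamma_lift :: "nat \<Rightarrow> (nat \<Rightarrow> int) \<Rightarrow> nat \<Rightarrow> int" where
  "gamma_lift d c k = (int k + 1) * c k + 2 * (int d + 2 - 2 * int k) * shift_seq c k"

text \<open>The right side of the recurrence for row \<open>d + 3\<close> in gamma coordinates,
  before division by \<open>d + 3\<close>; \<open>c1\<close> and \<open>c2\<close> are the rows
  \<open>d + 2\<close> and \<open>d + 1\<close>.\<close>

definition gamma_step :: "nat \<Rightarrow> (nat \<Rightarrow> int) \<Rightarrow> (nat \<Rightarrow> int) \<Rightarrow> nat \<Rightarrow> int" where
  "gamma_step d c1 c2 k = gamma_lift (d + 1) c1 k + gamma_lift (d + 1) (gamma_lift d c2) k
     + (int d + 1) * (c2 k - 4 * shift_seq c2 k)"

text \<open>The division is exact (\<open>gamma_coeff_rec\<close> below), because the polynomial on the other side of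
  the recurrence has integer coefficients.\<close>

fun gamma_coeff :: "nat \<Rightarrow> nat \<Rightarrow> int" where
  "gamma_coeff 0 = (\<lambda>k. 0)"
| "gamma_coeff (Suc 0) = (\<lambda>k. if k = 0 then 1 else 0)"
| "gamma_coeff (Suc (Suc 0)) = (\<lambda>k. if k = 0 then 1 else 0)"
| "gamma_coeff (Suc (Suc (Suc d))) = (\<lambda>k. if 2 * k \<le> d + 2
     then gamma_step d (gamma_coeff (Suc (Suc d))) (gamma_coeff (Suc d)) k div (int d + 3) else 0)"

lemma gamma_coeff_eq_0: "n \<le> 2 * k \<Longrightarrow> gamma_coeff n k = 0"
  by (cases n rule: gamma_coeff.cases) auto


lemma gamma_coeff_add_3:
  "gamma_coeff (d + 3) k = (if 2 * k \<le> d + 2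
     then gamma_step d (gamma_coeff (d + 2)) (gamma_coeff (d + 1)) k div (int d + 3) else 0)"
  by (simp add: numeral_eq_Suc)

section \<open>The operators of the recurrence in the gamma basis\<close>

definition pX :: "int poly" where
  "pX = [:0, 1:]"

definition gamma_basis :: "nat \<Rightarrow> nat \<Rightarrow> int poly" where
  "gamma_basis d k = pX ^ k * (1 + pX) ^ (d - 2 * k)"

text \<open>If \<open>G = p / (1 - t) ^ (m + 1)\<close>, then \<open>(t G)' = euler_lift m p / (1 - t) ^ (m + 2)\<close>.\<close>

definition euler_lift :: "nat \<Rightarrow> int poly \<Rightarrow> int poly" where
  "euler_lift m p = (1 + of_nat m * pX) * p + pX * (1 - pX) * pderiv p"

lemma one_plus_pX: "[:1, 1:] = 1 + pX"
  by (simp add: pX_def one_pCons)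

lemma pderiv_pX [simp]: "pderiv pX = 1"
  by (simp add: pX_def pderiv_pCons)

lemma smult_of_int: "smult c p = of_int c * (p :: int poly)"
  by (simp add: of_int_poly)

lemma pX_pderiv_power: "pX * pderiv (pX ^ k) = of_nat k * pX ^ k"
  by (cases k) (simp_all add: pderiv_power_Suc smult_of_int algebra_simps del: power_Suc, simp)

text \<open>With Y = 1 + X and e = d - 2k, taking out X^k Y^(e-1) leaves the identity (1 + (2k+e+1)
  X) Y + (1-X)(k Y + e X) = (k+1) Y^2 + 2e X.\<close>

lemma euler_lift_basis:
  assumes "2 * k \<le> d"
  shows "euler_lift (d + 1) (gamma_basis d k) = of_int (int k + 1) * gamma_basis (d + 1) k
    + of_int (2 * (int d - 2 * int k)) * gamma_basis (d + 1) (Suc k)"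
proof -
  define Y where "Y = 1 + pX"
  obtain e where d: "d = 2 * k + e" using assms le_iff_add by blast
  have b: "gamma_basis d k = pX ^ k * Y ^ e" "gamma_basis (d + 1) k = pX ^ k * Y ^ Suc e"
    by (simp_all add: gamma_basis_def Y_def d)
  have D: "pX * pderiv (pX ^ k * Y ^ e) = of_nat k * pX ^ k * Y ^ e + pX * pX ^ k * pderiv (Y ^ e)"
  proof -
    have "pX * pderiv (pX ^ k * Y ^ e) = (pX * pderiv (pX ^ k)) * Y ^ e + pX * pX ^ k * pderiv (Y ^ e)"
      by (simp only: pderiv_mult algebra_simps)
    then show ?thesis by (simp only: pX_pderiv_power)
  qed
  have E: "euler_lift (d + 1) (gamma_basis d k) = (1 + of_nat (d + 1) * pX) * (pX ^ k * Y ^ e)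
     + (1 - pX) * (of_nat k * pX ^ k * Y ^ e + pX * pX ^ k * pderiv (Y ^ e))"
    unfolding euler_lift_def b D[symmetric] by (simp only: ac_simps)
  have i: "of_int (int k + 1) = (of_nat k + 1 :: int poly)"
    "of_int (2 * (int d - 2 * int k)) = (2 * of_nat e :: int poly)"
    "of_nat (d + 1) = (2 * of_nat k + of_nat e + 1 :: int poly)"
    by (simp_all add: d)
  show ?thesis
  proof (cases e)
    \<comment> \<open>The exponent in \<open>gamma_basis (d + 1) (Suc k)\<close> is truncated to 0
      here, but its coefficient 2e vanishes.\<close>
    case 0
    then show ?thesis
      unfolding E unfolding b i by (simp add: Y_def algebra_simps)
  next
    case (Suc e')
    have b': "gamma_basis (d + 1) (Suc k) = pX * pX ^ k * Y ^ e'"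
      by (simp add: gamma_basis_def Y_def d Suc)
    have D': "pderiv (Y ^ e) = of_nat e * Y ^ e'"
      unfolding Suc pderiv_power_Suc smult_of_int by (simp add: Y_def pderiv_add)
    have "(1 + (2 * of_nat k + of_nat e + 1) * pX) * (pX ^ k * Y ^ e)
     + (1 - pX) * (of_nat k * pX ^ k * Y ^ e + pX * pX ^ k * (of_nat e * Y ^ e'))
     = (pX ^ k * Y ^ e') * ((1 + (2 * of_nat k + of_nat e + 1) * pX) * Y + (1 - pX) * (of_nat k * Y + of_nat e * pX))"
      unfolding Suc by (simp add: algebra_simps)
    also have "\<dots> = (pX ^ k * Y ^ e') * ((of_nat k + 1) * (Y * Y) + 2 * of_nat e * pX)"
      by (rule arg_cong[of _ _ "\<lambda>z. _ * z"]) (simp add: Y_def algebra_simps)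
    also have "\<dots> = (of_nat k + 1) * (pX ^ k * Y ^ Suc e) + 2 * of_nat e * (pX * pX ^ k * Y ^ e')"
      unfolding Suc by (simp add: algebra_simps)
    finally show ?thesis
      unfolding E unfolding b b' i D' .
  qed
qed

lemma one_minus_X_square_basis:
  assumes "2 * k \<le> d"
  shows "(1 - pX)\<^sup>2 * gamma_basis d k = gamma_basis (d + 2) k - 4 * gamma_basis (d + 2) (Suc k)"
proof -
  obtain e where d: "d = 2 * k + e" using assms le_iff_add by blast
  have "(1 - X)\<^sup>2 * (X ^ k * (1 + X) ^ e) = X ^ k * (1 + X) ^ (e + 2) - 4 * (X ^ Suc k * (1 + X) ^ e)"
    for X :: "int poly"
    by (simp add: power2_eq_square algebra_simps)
  then show ?thesis
    by (simp add: gamma_basis_def d)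
qed

text \<open>The freely chosen upper limit lets sums be shifted in their index without case
  distinctions at \<open>d div 2\<close>.\<close>

lemma gamma_expansion_eq_sum:
  assumes "\<And>k. d < 2 * k \<Longrightarrow> c k = 0" "d div 2 \<le> N"
  shows "gamma_expansion d c = (\<Sum>k\<le>N. of_int (c k) * gamma_basis d k)"
proof -
  have "(\<Sum>k\<le>N. of_int (c k) * gamma_basis d k) = (\<Sum>k=0..d div 2. of_int (c k) * gamma_basis d k)"
    by (rule sum.mono_neutral_right) (use assms in auto)
  then show ?thesis
    by (simp add: gamma_expansion_def gamma_basis_def smult_of_int pX_def[symmetric] one_plus_pX)
qed

lemma euler_lift_sum:
  fixes N :: nat
  shows "euler_lift m (\<Sum>k\<le>N. of_int (c k) * f k) = (\<Sum>k\<le>N. of_int (c k) * euler_lift m (f k))"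
proof -
  have add: "euler_lift m (p + q) = euler_lift m p + euler_lift m q" for p q
    by (simp add: euler_lift_def pderiv_add algebra_simps)
  have smult: "euler_lift m (of_int a * p) = of_int a * euler_lift m p" for a p
    unfolding smult_of_int[symmetric] euler_lift_def pderiv_smult by (simp add: smult_add_right)
  show ?thesis
    by (induction N) (simp_all add: add smult)
qed

lemma sum_shift_seq:
  "(\<Sum>k\<le>N. of_int (a (Suc k) * c k) * f (Suc k)) = (\<Sum>k\<le>Suc N. of_int (a k * shift_seq c k) * (f k :: int poly))"
  by (simp only: sum.atMost_Suc_shift shift_seq_simps) simp

lemma gamma_lift_support:
  assumes "\<And>k. d < 2 * k \<Longrightarrow> c k = 0" "d + 1 < 2 * k"
  shows "gamma_lift d c k = 0"
proof -
  obtain j where k: "k = Suc j" using assms(2) by (cases k) auto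
  \<comment> \<open>For d = 2j the entry \<open>c j\<close> may be nonzero, but then its factor d +
    2 - 2k is 0.\<close>
  have "d = 2 * j \<or> d < 2 * j" using assms(2) k by linarith
  then show ?thesis
    using assms(1)[of k] assms(1)[of j] k by (auto simp: gamma_lift_def)
qed

lemma euler_lift_gamma_expansion:
  assumes "\<And>k. d < 2 * k \<Longrightarrow> c k = 0"
  shows "euler_lift (d + 1) (gamma_expansion d c) = gamma_expansion (d + 1) (gamma_lift d c)"
proof -
  have summand: "of_int (c k) * euler_lift (d + 1) (gamma_basis d k) =
      of_int ((int k + 1) * c k) * gamma_basis (d + 1) k
      + of_int (2 * (int d + 2 - 2 * int (Suc k)) * c k) * gamma_basis (d + 1) (Suc k)" for k
  proof (cases "2 * k \<le> d")
    case True
    show ?thesis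
      unfolding euler_lift_basis[OF True] by (simp add: algebra_simps)
  qed (use assms in simp)
  have "euler_lift (d + 1) (gamma_expansion d c)
      = (\<Sum>k\<le>d. of_int (c k) * euler_lift (d + 1) (gamma_basis d k))"
    by (simp only: gamma_expansion_eq_sum[where N = d, OF assms] div_le_dividend euler_lift_sum)
  also have "\<dots> = (\<Sum>k\<le>d. of_int ((int k + 1) * c k) * gamma_basis (d + 1) k)
      + (\<Sum>k\<le>d. of_int (2 * (int d + 2 - 2 * int (Suc k)) * c k) * gamma_basis (d + 1) (Suc k))"
    by (simp only: summand sum.distrib)
  also have "(\<Sum>k\<le>d. of_int ((int k + 1) * c k) * gamma_basis (d + 1) k)
      = (\<Sum>k\<le>Suc d. of_int ((int k + 1) * c k) * gamma_basis (d + 1) k)"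
    using assms[of "Suc d"] by simp
  also have "(\<Sum>k\<le>d. of_int (2 * (int d + 2 - 2 * int (Suc k)) * c k) * gamma_basis (d + 1) (Suc k))
      = (\<Sum>k\<le>Suc d. of_int (2 * (int d + 2 - 2 * int k) * shift_seq c k) * gamma_basis (d + 1) k)"
    by (rule sum_shift_seq)
  also have "(\<Sum>k\<le>Suc d. of_int ((int k + 1) * c k) * gamma_basis (d + 1) k) + \<dots>
      = (\<Sum>k\<le>Suc d. of_int (gamma_lift d c k) * gamma_basis (d + 1) k)"
    by (simp only: gamma_lift_def of_int_add distrib_right sum.distrib)
  also have "\<dots> = gamma_expansion (d + 1) (gamma_lift d c)"
    by (rule gamma_expansion_eq_sum[symmetric]) (use gamma_lift_support[OF assms] in simp_all)
  finally show ?thesis .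
qed

lemma one_minus_X_square_gamma_expansion:
  assumes "\<And>k. d < 2 * k \<Longrightarrow> c k = 0"
  shows "(1 - pX)\<^sup>2 * gamma_expansion d c = gamma_expansion (d + 2) (\<lambda>k. c k - 4 * shift_seq c k)"
proof -
  have summand: "(1 - pX)\<^sup>2 * (of_int (c k) * gamma_basis d k) =
      of_int (c k) * gamma_basis (d + 2) k + of_int (- 4 * c k) * gamma_basis (d + 2) (Suc k)" for k
  proof (cases "2 * k \<le> d")
    case True
    have "(1 - pX)\<^sup>2 * (of_int (c k) * gamma_basis d k) = of_int (c k) * ((1 - pX)\<^sup>2 * gamma_basis d k)"
      by (simp only: ac_simps)
    also have "\<dots> = of_int (c k) * (gamma_basis (d + 2) k - 4 * gamma_basis (d + 2) (Suc k))"
      by (simp only: one_minus_X_square_basis[OF True])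
    finally show ?thesis by (simp add: algebra_simps)
  qed (use assms in simp)
  have supp: "c k - 4 * shift_seq c k = 0" if "d + 2 < 2 * k" for k
    using that assms[of k] assms[of "k - 1"] by (cases k) auto
  have "(1 - pX)\<^sup>2 * gamma_expansion d c = (\<Sum>k\<le>d. (1 - pX)\<^sup>2 * (of_int (c k) * gamma_basis d k))"
    by (simp only: gamma_expansion_eq_sum[where N = d, OF assms] div_le_dividend sum_distrib_left)
  also have "\<dots> = (\<Sum>k\<le>d. of_int (c k) * gamma_basis (d + 2) k)
      + (\<Sum>k\<le>d. of_int (- 4 * c k) * gamma_basis (d + 2) (Suc k))"
    by (simp only: summand sum.distrib)
  also have "(\<Sum>k\<le>d. of_int (c k) * gamma_basis (d + 2) k) = (\<Sum>k\<le>Suc d. of_int (c k) * gamma_basis (d + 2) k)"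
    using assms[of "Suc d"] by simp
  also have "(\<Sum>k\<le>d. of_int (- 4 * c k) * gamma_basis (d + 2) (Suc k))
      = (\<Sum>k\<le>Suc d. of_int (- 4 * shift_seq c k) * gamma_basis (d + 2) k)"
    by (rule sum_shift_seq)
  also have "(\<Sum>k\<le>Suc d. of_int (c k) * gamma_basis (d + 2) k) + \<dots>
      = (\<Sum>k\<le>Suc d. of_int (c k - 4 * shift_seq c k) * gamma_basis (d + 2) k)"
    by (simp add: algebra_simps flip: sum.distrib)
  also have "\<dots> = gamma_expansion (d + 2) (\<lambda>k. c k - 4 * shift_seq c k)"
    by (rule gamma_expansion_eq_sum[symmetric]) (use supp in simp_all)
  finally show ?thesis .
qed

lemma gamma_expansion_add: "gamma_expansion d (\<lambda>k. a k + b k) = gamma_expansion d a + gamma_expansion d b"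
  by (simp add: gamma_expansion_def smult_add_left sum.distrib)

lemma gamma_expansion_cmult:
  fixes x :: int
  shows "gamma_expansion d (\<lambda>k. x * b k) = smult x (gamma_expansion d b)"
  by (simp add: gamma_expansion_def smult_of_int sum_distrib_left mult.assoc)

lemma gamma_expansion_cong: "(\<And>k. k \<le> d div 2 \<Longrightarrow> a k = b k) \<Longrightarrow> gamma_expansion d a = gamma_expansion d b"
  by (simp add: gamma_expansion_def)

text \<open>The basis is unitriangular: t^k (1+t)^(d-2k) begins with t^k. Hence the k-th coefficient
  of \<open>smult a p\<close> is \<open>b k\<close> plus multiples of earlier \<open>b j\<close>,
  which are divisible by induction.\<close>

lemma dvd_gamma_coefficient:
  fixes p :: "int poly"
  assumes "smult a p = gamma_expansion d b" "k \<le> d div 2"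
  shows "a dvd b k"
  using assms(2)
proof (induction k rule: less_induct)
  case (less k)
  let ?B = "\<lambda>j. coeff ([:0, 1:] ^ j * [:1, 1:] ^ (d - 2 * j) :: int poly) k"
  have "?B k = 1"
    by (simp add: coeff_gamma_basis coeff_0_power)
  moreover have "a * coeff p k = (\<Sum>j=0..d div 2. b j * ?B j)"
    using arg_cong[OF assms(1), of "\<lambda>p. coeff p k"] by (simp add: gamma_expansion_def coeff_sum)
  ultimately have "a * coeff p k = b k + (\<Sum>j\<in>{0..d div 2} - {k}. b j * ?B j)"
    using less.prems by (subst (asm) sum.remove[of _ k]) simp_all
  moreover have "a dvd (\<Sum>j\<in>{0..d div 2} - {k}. b j * ?B j)"
  proof (rule dvd_sum)
    fix j assume "j \<in> {0..d div 2} - {k}"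
    then consider "j < k" "j \<le> d div 2" | "j > k" by force
    then show "a dvd b j * ?B j"
      by cases (simp_all add: less.IH coeff_gamma_basis)
  qed
  ultimately show ?case
    using dvd_add_left_iff[of a "\<Sum>j\<in>{0..d div 2} - {k}. b j * ?B j" "b k"] by (metis dvd_triv_left)
qed

lemma coeff_one_plus_X_power: "coeff ([:1, 1:] ^ m :: int poly) i = int (m choose i)"
proof (induction m arbitrary: i)
  case (Suc m)
  then show ?case by (cases i) (simp_all add: coeff_pCons)
qed (simp add: coeff_1)

lemma palindromic_gamma_expansion: "palindromic d (gamma_expansion d (c :: nat \<Rightarrow> int))"
proof -
  have basis: "coeff ([:0, 1:] ^ k * [:1, 1:] ^ (d - 2 * k) :: int poly) i = coeff ([:0, 1:] ^ k * [:1, 1:] ^ (d - 2 * k)) (d - i)"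
    if "k \<le> d div 2" "i \<le> d" for k i
  proof -
    consider "i < k" | "d - i < k" | "k \<le> i" "k \<le> d - i" by linarith
    then show ?thesis
    proof cases
      case 3
      then have "d - i - k = (d - 2 * k) - (i - k)" "i - k \<le> d - 2 * k" using that by linarith+
      then show ?thesis
        using 3 binomial_symmetric[of "i - k" "d - 2 * k"]
        unfolding coeff_gamma_basis coeff_one_plus_X_power by simp
    next
      case 1
      then have "d - 2 * k < d - i - k" using that by linarith
      then show ?thesis using 1 unfolding coeff_gamma_basis coeff_one_plus_X_power by (simp add: binomial_eq_0)
    next
      case 2
      then have "d - 2 * k < i - k" using that by linarith
      then show ?thesis using 2 unfolding coeff_gamma_basis coeff_one_plus_X_power by (simp add: binomial_eq_0)
    qed
  qed
  have deg: "degree (gamma_expansion d c) \<le> d"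
    unfolding gamma_expansion_def
  proof (rule degree_sum_le)
    fix k assume k: "k \<in> {0..d div 2}"
    have "degree ([:0, 1:] ^ k * [:1, 1:] ^ (d - 2 * k) :: int poly) \<le> k + (d - 2 * k)"
      by (rule order.trans[OF degree_mult_le]) (simp add: degree_linear_power degree_power_eq)
    also have "\<dots> \<le> d" using k by auto
    finally show "degree (smult (c k) ([:0, 1:] ^ k * [:1, 1:] ^ (d - 2 * k))) \<le> d"
      by (rule order.trans[OF degree_smult_le])
  qed simp
  have sym: "coeff (gamma_expansion d c) i = coeff (gamma_expansion d c) (d - i)" if "i \<le> d" for i
    unfolding gamma_expansion_def coeff_sum coeff_smult
    by (rule sum.cong[OF refl], rule arg_cong[of _ _ "\<lambda>z. _ * z"], rule basis) (use that in simp_all)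
  show ?thesis
    unfolding palindromic_def by (intro conjI allI impI deg sym)
qed

text \<open>The two conclusions depend on each other: the expansions of two consecutive rows make
  the next division exact, and exactness yields the next expansion.\<close>

lemma gamma_recursion:
  fixes p :: "nat \<Rightarrow> int poly"
  assumes base: "p 1 = 1" "p 2 = [:1, 1:]"
    and rec: "\<And>d. smult (int d + 3) (p (d + 3)) =
      euler_lift (d + 2) (p (d + 2)) + euler_lift (d + 2) (euler_lift (d + 1) (p (d + 1)))
      + smult (int d + 1) ((1 - pX)\<^sup>2 * p (d + 1))"
  shows gamma_recursion_expansion: "p (n + 1) = gamma_expansion n (gamma_coeff (n + 1))"
    and gamma_recursion_coeff: "2 * k \<le> d + 2 \<Longrightarrow>
      (int d + 3) * gamma_coeff (d + 3) k = gamma_step d (gamma_coeff (d + 2)) (gamma_coeff (d + 1)) k"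
proof -
  have supp: "gamma_coeff (d + 1) k = 0" if "d < 2 * k" for d k
    using that by (simp add: gamma_coeff_eq_0)
  have supp': "gamma_coeff (d + 2) k = 0" if "d + 1 < 2 * k" for d k
    using that by (simp add: gamma_coeff_eq_0)
  have step: "smult (int d + 3) (p (d + 3)) = gamma_expansion (d + 2) (gamma_step d (gamma_coeff (d + 2)) (gamma_coeff (d + 1)))"
    if "p (d + 2) = gamma_expansion (d + 1) (gamma_coeff (d + 2))" "p (d + 1) = gamma_expansion d (gamma_coeff (d + 1))" for d
  proof -
    have "euler_lift (d + 2) (p (d + 2)) = gamma_expansion (d + 2) (gamma_lift (d + 1) (gamma_coeff (d + 2)))"
      using euler_lift_gamma_expansion[of "d + 1" "gamma_coeff (d + 2)", OF supp'] that(1) by simp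
    moreover have "euler_lift (d + 2) (euler_lift (d + 1) (p (d + 1)))
        = gamma_expansion (d + 2) (gamma_lift (d + 1) (gamma_lift d (gamma_coeff (d + 1))))"
      using euler_lift_gamma_expansion[of d "gamma_coeff (d + 1)", OF supp]
        euler_lift_gamma_expansion[of "d + 1" "gamma_lift d (gamma_coeff (d + 1))", OF gamma_lift_support[OF supp]] that(2)
      by simp
    moreover have "smult (int d + 1) ((1 - pX)\<^sup>2 * p (d + 1))
        = gamma_expansion (d + 2) (\<lambda>k. (int d + 1) * (gamma_coeff (d + 1) k - 4 * shift_seq (gamma_coeff (d + 1)) k))"
      by (simp only: gamma_expansion_cmult that(2) one_minus_X_square_gamma_expansion[of d "gamma_coeff (d + 1)", OF supp])
    ultimately show ?thesis
      by (simp only: rec gamma_step_def[abs_def] gamma_expansion_add)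
  qed
  have gamma_coeff: "(int d + 3) * gamma_coeff (d + 3) k = gamma_step d (gamma_coeff (d + 2)) (gamma_coeff (d + 1)) k"
    if "p (d + 2) = gamma_expansion (d + 1) (gamma_coeff (d + 2))" "p (d + 1) = gamma_expansion d (gamma_coeff (d + 1))"
      "2 * k \<le> d + 2" for d k
    using dvd_gamma_coefficient[OF step[OF that(1,2)], of k] that(3) by (auto simp: gamma_coeff_add_3)
  show expansion: "p (n + 1) = gamma_expansion n (gamma_coeff (n + 1))" for n
  proof (induction n rule: less_induct)
    case (less n)
    consider "n = 0" | "n = 1" | d where "n = d + 2"
      by (metis One_nat_def Suc_1 add_2_eq_Suc' not0_implies_Suc)
    then show ?case
    proof cases
      case 1
      then show ?thesis using base by (simp add: gamma_expansion_def)
    next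
      case 2
      then show ?thesis using base by (simp add: gamma_expansion_def eval_nat_numeral)
    next
      case 3
      have prev: "p (d + 2) = gamma_expansion (d + 1) (gamma_coeff (d + 2))" "p (d + 1) = gamma_expansion d (gamma_coeff (d + 1))"
        using less.IH[of d] less.IH[of "d + 1"] 3 by (simp_all add: numeral_2_eq_2)
      have "smult (int d + 3) (p (d + 3)) = gamma_expansion (d + 2) (\<lambda>k. (int d + 3) * gamma_coeff (d + 3) k)"
        unfolding step[OF prev] by (rule gamma_expansion_cong) (use gamma_coeff[OF prev] in simp)
      then have "smult (int d + 3) (p (d + 3) - gamma_expansion (d + 2) (gamma_coeff (d + 3))) = 0"
        by (simp add: gamma_expansion_cmult smult_diff_right)
      then have "p (d + 3) = gamma_expansion (d + 2) (gamma_coeff (d + 3))"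
        by simp
      then show ?thesis using 3 by (simp add: numeral_3_eq_3)
    qed
  qed
  show "2 * k \<le> d + 2 \<Longrightarrow>
      (int d + 3) * gamma_coeff (d + 3) k = gamma_step d (gamma_coeff (d + 2)) (gamma_coeff (d + 1)) k"
    by (rule gamma_coeff) (use expansion[of d] expansion[of "d + 1"] in \<open>simp_all add: numeral_2_eq_2\<close>)
qed

subsection \<open>The recurrence\<close>

text \<open>The exponent is the matrix size \<open>R\<close> with \<open>n\<close> fixed, whereas in
  \<open>weighted_gf\<close> it is the entry sum.\<close>

definition matrix_gf :: "nat \<Rightarrow> int fps" where
  "matrix_gf n = Abs_fps (\<lambda>R. int (card (sym_matrices R n)))"

lemma binomial_gf: "(1 - fps_X) ^ Suc n * Abs_fps (\<lambda>m. int ((n + m) choose n)) = 1"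
proof (induction n)
  case 0
  show ?case
    by (rule fps_ext) (simp add: left_diff_distrib)
next
  case (Suc n)
  have "(1 - fps_X) * Abs_fps (\<lambda>m. int ((Suc n + m) choose Suc n)) = Abs_fps (\<lambda>m. int ((n + m) choose n))"
  proof (rule fps_ext)
    fix m
    show "fps_nth ((1 - fps_X) * Abs_fps (\<lambda>m. int ((Suc n + m) choose Suc n))) m
        = fps_nth (Abs_fps (\<lambda>m. int ((n + m) choose n))) m"
      by (cases m) (simp_all add: left_diff_distrib)
  qed
  then show ?case
    using Suc.IH by (simp only: power_Suc2[of _ "Suc n"] mult.assoc)
qed

text \<open>The binomial vanishes for \<open>R \<le> d\<close>, so the series starts at
  \<open>R = d + 1\<close>; by \<open>d < n\<close> the subtraction is never truncated.\<close>

lemma shifted_binomial_gf: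
  assumes "d < n"
  shows "(1 - fps_X) ^ Suc n * Abs_fps (\<lambda>R. int ((n + R - 1 - d) choose n)) = fps_X ^ Suc d"
proof -
  have "Abs_fps (\<lambda>R. int ((n + R - 1 - d) choose n)) = fps_X ^ Suc d * Abs_fps (\<lambda>m. int ((n + m) choose n))"
  proof (rule fps_ext)
    fix R
    show "fps_nth (Abs_fps (\<lambda>R. int ((n + R - 1 - d) choose n))) R
        = fps_nth (fps_X ^ Suc d * Abs_fps (\<lambda>m. int ((n + m) choose n))) R"
    proof (cases "R < Suc d")
      case True
      then have "n + R - 1 - d < n" using assms by simp
      then show ?thesis using True by (simp add: fps_X_power_mult_nth del: power_Suc)
    next
      case False
      then have "n + R - 1 - d = n + (R - Suc d)" by simp
      then show ?thesis using False by (simp add: fps_X_power_mult_nth del: power_Suc)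
    qed
  qed
  then show ?thesis
    by (metis binomial_gf mult.left_commute mult.right_neutral)
qed

lemma des_less:
  assumes "n \<ge> 1"
  shows "des n \<pi> < n"
proof -
  have "des n \<pi> \<le> card {1..n - 1}"
    unfolding des_def DES_def by (intro card_mono) auto
  then show ?thesis using assms by simp
qed

lemma matrix_gf_eq:
  assumes "n \<ge> 1"
  shows "(1 - fps_X) ^ Suc n * matrix_gf n = fps_X * fps_of_poly (involution_des_poly n)"
proof -
  have "matrix_gf n = (\<Sum>\<pi>\<in>involutions n. Abs_fps (\<lambda>R. int ((n + R - 1 - des n \<pi>) choose n)))"
    by (rule fps_ext) (simp add: matrix_gf_def card_sym_matrices_eq_sum fps_sum_nth)
  then have "(1 - fps_X) ^ Suc n * matrix_gf n = (\<Sum>\<pi>\<in>involutions n. fps_X ^ Suc (des n \<pi>))"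
    by (simp only: sum_distrib_left shifted_binomial_gf[OF des_less[OF assms]])
  then show ?thesis
    by (simp add: involution_des_poly_def fps_of_poly_sum fps_of_poly_monom' sum_distrib_left)
qed

text \<open>The additional factor X on the right is the one left over from X^(d+1) in
  \<open>shifted_binomial_gf\<close>. It turns the derivative of t G into X d/dX, which multiplies
  the R-th coefficient by R.\<close>

lemma euler_lift_gf:
  assumes "(1 - fps_X) ^ Suc m * G = fps_X * fps_of_poly p"
  shows "(1 - fps_X) ^ Suc (Suc m) * (fps_X * fps_deriv G) = fps_X * fps_of_poly (euler_lift m p)"
proof -
  define Q where "Q = (1 - fps_X :: int fps)"
  define P where "P = fps_of_poly p"
  have dQ: "fps_deriv Q = -1" by (simp add: Q_def)
  have "fps_deriv (Q ^ Suc m * G) = fps_deriv (fps_X * P)"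
    using assms by (simp add: Q_def P_def)
  then have "Q ^ Suc m * fps_deriv G = P + fps_X * fps_deriv P + of_nat (Suc m) * (Q ^ m * G)"
    by (simp add: fps_deriv_power' dQ algebra_simps del: power_Suc of_nat_Suc)
  then have "Q * fps_X * (Q ^ Suc m * fps_deriv G)
      = Q * fps_X * (P + fps_X * fps_deriv P + of_nat (Suc m) * (Q ^ m * G))"
    by (rule arg_cong)
  also have "\<dots> = Q * fps_X * (P + fps_X * fps_deriv P) + of_nat (Suc m) * fps_X * (Q ^ Suc m * G)"
    by (simp add: algebra_simps)
  also have "Q ^ Suc m * G = fps_X * P"
    using assms by (simp only: Q_def P_def)
  also have "Q * fps_X * (P + fps_X * fps_deriv P) + of_nat (Suc m) * fps_X * (fps_X * P)
      = fps_X * ((1 + of_nat m * fps_X) * P + fps_X * (1 - fps_X) * fps_deriv P)"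
    by (simp add: Q_def algebra_simps)
  also have "(1 + of_nat m * fps_X) * P + fps_X * (1 - fps_X) * fps_deriv P = fps_of_poly (euler_lift m p)"
    by (simp add: P_def euler_lift_def pX_def fps_of_poly_add fps_of_poly_diff fps_of_poly_mult fps_of_poly_pderiv
        of_nat_poly fps_of_poly_const fps_of_nat del: mult_pCons_left mult_pCons_right)
  finally show ?thesis
    by (simp only: Q_def power_Suc ac_simps)
qed

lemma involution_des_poly_rec:
  "smult (int d + 3) (involution_des_poly (d + 3)) =
     euler_lift (d + 2) (involution_des_poly (d + 2))
     + euler_lift (d + 2) (euler_lift (d + 1) (involution_des_poly (d + 1)))
     + smult (int d + 1) ((1 - pX)\<^sup>2 * involution_des_poly (d + 1))"
proof -
  let ?G = "matrix_gf" and ?I = "involution_des_poly" and ?Q = "1 - fps_X :: int fps"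
  have rec: "of_int (int d + 3) * ?G (d + 3)
      = fps_X * fps_deriv (?G (d + 2)) + fps_X * fps_deriv (fps_X * fps_deriv (?G (d + 1)))
        + of_int (int d + 1) * ?G (d + 1)"
  proof (rule fps_ext)
    fix R
    have XD: "fps_nth (fps_X * fps_deriv f) R = int R * fps_nth f R" for f :: "int fps" and R
      by (cases R) (simp_all)
    show "fps_nth (of_int (int d + 3) * ?G (d + 3)) R
      = fps_nth (fps_X * fps_deriv (?G (d + 2)) + fps_X * fps_deriv (fps_X * fps_deriv (?G (d + 1)))
        + of_int (int d + 1) * ?G (d + 1)) R"
      unfolding fps_add_nth XD fps_of_int[symmetric] fps_mult_left_const_nth
      using card_sym_matrices_recurrence[of "d + 1" R]
      by (simp add: matrix_gf_def algebra_simps power2_eq_square eval_nat_numeral)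
  qed
  have Q: "?Q ^ (d + 4) * ?G (d + 3) = fps_X * fps_of_poly (?I (d + 3))"
    "?Q ^ (d + 3) * ?G (d + 2) = fps_X * fps_of_poly (?I (d + 2))"
    "?Q ^ (d + 2) * ?G (d + 1) = fps_X * fps_of_poly (?I (d + 1))"
    using matrix_gf_eq[of "d + 3"] matrix_gf_eq[of "d + 2"] matrix_gf_eq[of "d + 1"]
    by (simp_all add: eval_nat_numeral)
  have suc: "Suc (d + 1) = d + 2" "Suc (d + 2) = d + 3" "Suc (d + 3) = d + 4"
    by simp_all
  have L1: "?Q ^ (d + 4) * (fps_X * fps_deriv (?G (d + 2))) = fps_X * fps_of_poly (euler_lift (d + 2) (?I (d + 2)))"
    by (rule euler_lift_gf[of "d + 2", unfolded suc, OF Q(2)])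
  have "?Q ^ (d + 3) * (fps_X * fps_deriv (?G (d + 1))) = fps_X * fps_of_poly (euler_lift (d + 1) (?I (d + 1)))"
    by (rule euler_lift_gf[of "d + 1", unfolded suc, OF Q(3)])
  then have L2: "?Q ^ (d + 4) * (fps_X * fps_deriv (fps_X * fps_deriv (?G (d + 1))))
      = fps_X * fps_of_poly (euler_lift (d + 2) (euler_lift (d + 1) (?I (d + 1))))"
    by (rule euler_lift_gf[of "d + 2", unfolded suc])
  have "d + 4 = 2 + (d + 2)" by simp
  then have Q2: "?Q ^ (d + 4) = ?Q\<^sup>2 * ?Q ^ (d + 2)"
    by (simp only: power_add)
  have L3: "?Q ^ (d + 4) * ?G (d + 1) = fps_X * fps_of_poly ((1 - pX)\<^sup>2 * ?I (d + 1))"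
    unfolding Q2 mult.assoc Q(3)
    by (simp add: fps_of_poly_mult fps_of_poly_power fps_of_poly_diff pX_def mult.left_commute)
  have "fps_X * fps_of_poly (smult (int d + 3) (?I (d + 3))) = of_int (int d + 3) * (?Q ^ (d + 4) * ?G (d + 3))"
    unfolding Q(1) fps_of_poly_smult fps_of_int[symmetric] by (simp add: mult.left_commute)
  also have "\<dots> = ?Q ^ (d + 4) * (of_int (int d + 3) * ?G (d + 3))"
    by (rule mult.left_commute)
  also have "\<dots> = ?Q ^ (d + 4) * (fps_X * fps_deriv (?G (d + 2)))
      + ?Q ^ (d + 4) * (fps_X * fps_deriv (fps_X * fps_deriv (?G (d + 1))))
      + of_int (int d + 1) * (?Q ^ (d + 4) * ?G (d + 1))"
    unfolding rec distrib_left by (simp only: mult.left_commute)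
  also have "\<dots> = fps_X * (fps_of_poly (euler_lift (d + 2) (?I (d + 2)))
      + fps_of_poly (euler_lift (d + 2) (euler_lift (d + 1) (?I (d + 1))))
      + of_int (int d + 1) * fps_of_poly ((1 - pX)\<^sup>2 * ?I (d + 1)))"
    unfolding L1 L2 L3 distrib_left by (simp only: mult.left_commute)
  finally have "fps_of_poly (smult (int d + 3) (?I (d + 3))) = fps_of_poly (euler_lift (d + 2) (?I (d + 2)))
      + fps_of_poly (euler_lift (d + 2) (euler_lift (d + 1) (?I (d + 1))))
      + of_int (int d + 1) * fps_of_poly ((1 - pX)\<^sup>2 * ?I (d + 1))"
    by simp
  moreover have "fps_const z = of_int z" for z :: int
    by (metis fps_of_int of_int_eq_id id_apply)
  ultimately have "fps_of_poly (smult (int d + 3) (?I (d + 3))) = fps_of_poly (euler_lift (d + 2) (?I (d + 2))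
      + euler_lift (d + 2) (euler_lift (d + 1) (?I (d + 1))) + smult (int d + 1) ((1 - pX)\<^sup>2 * ?I (d + 1)))"
    by (simp only: fps_of_poly_add fps_of_poly_smult)
  then show ?thesis by (simp only: fps_of_poly_eq_iff)
qed

lemma involution_des_poly_1: "involution_des_poly 1 = 1"
proof -
  have "involutions 1 = {id}" by (auto simp: involutions_def)
  then show ?thesis by (simp add: involution_des_poly_def des_def DES_def monom_0 one_pCons)
qed

lemma involution_des_poly_2: "involution_des_poly 2 = [:1, 1:]"
proof -
  have two: "{1..2} = {1, 2 :: nat}" by auto
  have inv: "involutions 2 = {id, Transposition.transpose 1 2}"
    unfolding involutions_def two permutes_doubleton_iff by auto
  have ne: "id \<noteq> Transposition.transpose 1 (2 :: nat)"
    by (metis id_apply numeral_One numeral_eq_iff semiring_norm(85) transpose_apply_first)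
  have "DES 2 id = {}" "DES 2 (Transposition.transpose 1 2) = {1}"
    by (auto simp: DES_def Transposition.transpose_def)
  then show ?thesis
    using ne by (simp add: involution_des_poly_def inv des_def monom_0 monom_Suc)
qed

lemma involution_des_poly_expansion: "involution_des_poly (n + 1) = gamma_expansion n (gamma_coeff (n + 1))"
  and gamma_coeff_rec: "2 * k \<le> d + 2 \<Longrightarrow>
    (int d + 3) * gamma_coeff (d + 3) k = gamma_step d (gamma_coeff (d + 2)) (gamma_coeff (d + 1)) k"
  using gamma_recursion[OF involution_des_poly_1 involution_des_poly_2 involution_des_poly_rec] by blast+

subsection \<open>Positivity\<close>

definition gamma_coeff_row :: "nat \<Rightarrow> int list" where
  "gamma_coeff_row n = map (gamma_coeff n) [0..<Suc ((n - 1) div 2)]"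

text \<open>Rows are kept as lists so that each is evaluated once; unfolding
  \<open>gamma_coeff\<close> would recompute earlier rows again and again.\<close>

definition next_row :: "nat \<Rightarrow> int list \<Rightarrow> int list \<Rightarrow> int list" where
  "next_row d xs ys = map (\<lambda>k. gamma_step d (\<lambda>j. if j < length xs then xs ! j else 0)
       (\<lambda>j. if j < length ys then ys ! j else 0) k div (int d + 3)) [0..<Suc ((d + 2) div 2)]"

text \<open>The second inequality for odd \<open>n\<close> is the bound for 2k+3 with k = h - 1. The
  guard \<open>4 \<le> h\<close> is sharp: row 7 is 1, 6, 18, 0, and 5 * 18 exceeds 12 * 6.\<close>

definition row_ok :: "nat \<Rightarrow> (nat \<Rightarrow> int) \<Rightarrow> bool" where
  "row_ok n c = (let h = (n - 1) div 2 in
     (\<forall>k\<in>set [0..<Suc h]. 0 \<le> c k) \<and>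
     (4 \<le> h \<longrightarrow>
       (if odd n then (3 * int h + 1) * c h \<le> 4 * c (h - 1) \<and> (int h + 2) * c (h - 1) \<le> 12 * c (h - 2)
        else (int h + 3) * c h \<le> 5 * c (h - 1))))"

text \<open>Tests \<open>f\<close> successive rows from row \<open>d + 3\<close> on, with
  \<open>xs\<close> and \<open>ys\<close> as rows \<open>d + 2\<close> and
  \<open>d + 1\<close>.\<close>

fun rows_ok :: "nat \<Rightarrow> nat \<Rightarrow> int list \<Rightarrow> int list \<Rightarrow> bool" where
  "rows_ok 0 d xs ys = True"
| "rows_ok (Suc f) d xs ys =
     (let zs = next_row d xs ys in row_ok (d + 3) (nth zs) \<and> rows_ok f (Suc d) zs xs)"

lemma row_ok_cong:
  assumes "\<And>k. k \<le> (n - 1) div 2 \<Longrightarrow> c k = c' k"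
  shows "row_ok n c = row_ok n c'"
  using assms by (auto simp: row_ok_def Let_def)

lemma gamma_coeff_row_lookup:
  "n \<ge> 1 \<Longrightarrow> (\<lambda>j. if j < length (gamma_coeff_row n) then gamma_coeff_row n ! j else 0) = gamma_coeff n"
  by (rule ext) (auto simp: gamma_coeff_row_def gamma_coeff_eq_0 simp del: upt_Suc)

lemma next_row_gamma_coeff: "next_row d (gamma_coeff_row (d + 2)) (gamma_coeff_row (d + 1)) = gamma_coeff_row (d + 3)"
proof -
  have d: "1 \<le> d + 2" "1 \<le> d + 1" by simp_all
  show ?thesis
    unfolding next_row_def gamma_coeff_row_lookup[OF d(1)] gamma_coeff_row_lookup[OF d(2)] gamma_coeff_row_def[of "d + 3"]
    by (rule map_cong) (auto simp: gamma_coeff_add_3 simp del: upt_Suc)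
qed

lemma rows_ok_gamma_coeff:
  "rows_ok f d (gamma_coeff_row (d + 2)) (gamma_coeff_row (d + 1)) \<Longrightarrow> d + 3 \<le> n \<Longrightarrow> n < d + 3 + f \<Longrightarrow> row_ok n (gamma_coeff n)"
proof (induction f arbitrary: d)
  case (Suc f)
  have rows: "row_ok (d + 3) (nth (gamma_coeff_row (d + 3)))" "rows_ok f (Suc d) (gamma_coeff_row (d + 3)) (gamma_coeff_row (d + 2))"
    using Suc.prems(1) by (simp_all only: rows_ok.simps next_row_gamma_coeff Let_def)
  show ?case
  proof (cases "n = d + 3")
    case True
    have "row_ok n (nth (gamma_coeff_row n)) = row_ok n (gamma_coeff n)"
      by (rule row_ok_cong) (simp add: gamma_coeff_row_def del: upt_Suc)
    then show ?thesis using rows True by simp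
  next
    case False
    have "Suc d + 2 = d + 3" "Suc d + 1 = d + 2" by simp_all
    with rows(2) have "rows_ok f (Suc d) (gamma_coeff_row (Suc d + 2)) (gamma_coeff_row (Suc d + 1))" by (simp only:)
    then show ?thesis using Suc.IH[of "Suc d"] False Suc.prems(2,3) by linarith
  qed
qed simp

lemma row_ok_small:
  assumes "3 \<le> n" "n \<le> 48"
  shows "row_ok n (gamma_coeff n)"
proof -
  \<comment> \<open>These are the 46 rows from 3 to 48; rows 1 and 2 are both
    \<open>[1]\<close>.\<close>
  have "rows_ok 46 0 [1] [1]"
    by code_simp
  moreover have "gamma_coeff_row 2 = [1]" "gamma_coeff_row 1 = [1]"
    by (simp_all add: gamma_coeff_row_def eval_nat_numeral)
  ultimately show ?thesis
    using rows_ok_gamma_coeff[of 46 0 n] assms by (simp only: add_0)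
qed

text \<open>Here \<open>x\<close>, \<open>u\<close>, \<open>v\<close> stand for three consecutive rows \<open>n = 2 h + 1\<close>, \<open>n - 1\<close>, \<open>n - 2\<close>, and
  \<open>x0, x1, \<dots>\<close> are the entries of a row counted from its last one, and likewise in
  \<open>even_row_step\<close> with \<open>n = 2 h + 2\<close>.\<close>

lemma odd_row_step:
  fixes h :: int
  assumes h: "h \<ge> 24"
    and nonneg: "u0 \<ge> 0" "u1 \<ge> 0" "u2 \<ge> 0" "v0 \<ge> 0" "v1 \<ge> 0" "v2 \<ge> 0" "v3 \<ge> 0"
    and hyp: "(h + 2) * u0 \<le> 5 * u1" "(3 * h - 2) * v0 \<le> 4 * v1" "(h + 1) * v1 \<le> 12 * v2"
    and x0: "(2 * h + 1) * x0 = 2 * u0 + (4 - 6 * h) * v0 + 8 * v1"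
    and x1: "(2 * h + 1) * x1 = h * u0 + 6 * u1 + (h * h + 2 * h - 1) * v0 + (2 * h - 2) * v1 + 48 * v2"
    and x2: "(2 * h + 1) * x2 = (h - 1) * u1 + 10 * u2 + h * h * v1 + (10 * h - 24) * v2 + 120 * v3"
  shows "0 \<le> x0" "(3 * h + 1) * x0 \<le> 4 * x1" "(h + 2) * x1 \<le> 12 * x2"
proof -
  \<comment> \<open>After expansion the claims are linear in monomials such as
    \<open>h * h * v1\<close>. These products, and those in \<open>hyp'\<close>, reduce them to
    linear arithmetic.\<close>
  have ge: "(h - 24) * u0 \<ge> 0" "(h - 24) * u1 \<ge> 0" "(h - 24) * u2 \<ge> 0" "(h - 24) * v0 \<ge> 0"
    "(h - 24) * v1 \<ge> 0" "(h - 24) * v2 \<ge> 0" "h * ((h - 24) * v1) \<ge> 0" "h * ((h - 24) * v0) \<ge> 0"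
    "h * ((h - 24) * u0) \<ge> 0"
    using h nonneg by simp_all
  have hyp': "h * ((h + 2) * u0) \<le> h * (5 * u1)" "h * ((3 * h - 2) * v0) \<le> h * (4 * v1)"
    "h * (h * ((3 * h - 2) * v0)) \<le> h * (h * (4 * v1))"
    "h * ((h + 1) * v1) \<le> h * (12 * v2)"
    using h hyp by (simp_all add: mult_left_mono)
  have pos: "2 * h + 1 > 0" using h by simp
  \<comment> \<open>Apart from \<open>2 * u0\<close>, this is twice the second hypothesis.\<close>
  have "(2 * h + 1) * x0 \<ge> 0"
    unfolding x0 using hyp nonneg by (simp add: algebra_simps)
  then show "0 \<le> x0" using pos by (simp add: zero_le_mult_iff)
  \<comment> \<open>The left side exceeds the right by \<open>16 * (h + 1) * v1\<close> in
    \<open>v1\<close>, which \<open>192 * v2\<close> absorbs with nothing to spare by the third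
    hypothesis. The excess \<open>(2 * h + 2) * u0\<close> is covered by
    \<open>24 * u1\<close>.\<close>
  have "(3 * h + 1) * ((2 * h + 1) * x0) \<le> 4 * ((2 * h + 1) * x1)"
    unfolding x0 x1 using ge hyp hyp' nonneg by (simp add: algebra_simps)
  then have "(2 * h + 1) * ((3 * h + 1) * x0) \<le> (2 * h + 1) * (4 * x1)" by (simp only: ac_simps)
  then show "(3 * h + 1) * x0 \<le> 4 * x1" using pos by (simp only: mult_le_cancel_left_pos)
  \<comment> \<open>The threshold 24 arises here: bounding \<open>h * (h + 2) * u0\<close> by
    \<open>5 * h * u1\<close>, the terms in \<open>u1\<close> require 5h + 6(h+2) \<le>
    12(h-1).\<close>
  have "(h + 2) * ((2 * h + 1) * x1) \<le> 12 * ((2 * h + 1) * x2)"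
    unfolding x1 x2 using ge hyp hyp' nonneg by (simp add: algebra_simps)
  then have "(2 * h + 1) * ((h + 2) * x1) \<le> (2 * h + 1) * (12 * x2)" by (simp only: ac_simps)
  then show "(h + 2) * x1 \<le> 12 * x2" using pos by (simp only: mult_le_cancel_left_pos)
qed

lemma even_row_step:
  fixes h :: int
  assumes h: "h \<ge> 24"
    and nonneg: "u0 \<ge> 0" "u1 \<ge> 0" "u2 \<ge> 0" "v0 \<ge> 0" "v1 \<ge> 0" "v2 \<ge> 0"
    and hyp: "(3 * h + 1) * u0 \<le> 4 * u1" "(h + 2) * u1 \<le> 12 * u2" "(h + 2) * v0 \<le> 5 * v1"
    and y0: "(2 * h + 2) * y0 = (h + 1) * u0 + 4 * u1 + (2 - 2 * h) * v0 + 24 * v1"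
    and y1: "(2 * h + 2) * y1 = h * u1 + 8 * u2 + (h * h + 2 * h) * v0 + (6 * h - 8) * v1 + 80 * v2"
  shows "0 \<le> y0" "(h + 3) * y0 \<le> 5 * y1"
proof -
  have ge: "(h - 24) * u0 \<ge> 0" "(h - 24) * u1 \<ge> 0" "(h - 24) * u2 \<ge> 0" "(h - 24) * v0 \<ge> 0"
    "(h - 24) * v1 \<ge> 0" "h * ((h - 24) * v0) \<ge> 0"
    using h nonneg by simp_all
  have hyp': "h * ((3 * h + 1) * u0) \<le> h * (4 * u1)"
    using h hyp by (simp_all add: mult_left_mono)
  have pos: "2 * h + 2 > 0" using h by simp
  have "(2 * h + 2) * y0 \<ge> 0"
    unfolding y0 using hyp nonneg ge by (simp add: algebra_simps)
  then show "0 \<le> y0" using pos by (simp add: zero_le_mult_iff)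
  \<comment> \<open>The term in \<open>h * h * u0\<close> costs about 4/3 h u1, which
    \<open>40 * u2\<close>, at least 10/3 (h+2) u1, pays for. The terms in \<open>v1\<close> need
    24(h+3) \<le> 30h - 40, true from 19 on.\<close>
  have "(h + 3) * ((2 * h + 2) * y0) \<le> 5 * ((2 * h + 2) * y1)"
    unfolding y0 y1 using ge hyp hyp' nonneg by (simp add: algebra_simps)
  then have "(2 * h + 2) * ((h + 3) * y0) \<le> (2 * h + 2) * (5 * y1)" by (simp only: ac_simps)
  then show "(h + 3) * y0 \<le> 5 * y1" using pos by (simp only: mult_le_cancel_left_pos)
qed



section \<open>The five-term recurrence and the induction over rows\<close>

lemma gamma_coeff_rec_explicit:
  assumes "m \<ge> 1"
  shows "(2 * int j + int m + 4) * gamma_coeff (2 * j + m + 4) (j + 2) =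
    (int j + 3) * gamma_coeff (2 * j + m + 3) (j + 2) + 2 * int m * gamma_coeff (2 * j + m + 3) (j + 1)
    + ((int j + 3) * (int j + 3) + (2 * int j + int m + 2)) * gamma_coeff (2 * j + m + 2) (j + 2)
    + ((int j + 1) * (4 * int m - 10) + 2 * int m - 4) * gamma_coeff (2 * j + m + 2) (j + 1)
    + 4 * int m * (int m + 1) * gamma_coeff (2 * j + m + 2) j"
proof -
  have e: "2 * j + m + 1 + 3 = 2 * j + m + 4" "2 * j + m + 1 + 2 = 2 * j + m + 3" "2 * j + m + 1 + 1 = 2 * j + m + 2"
    by simp_all
  have j2: "j + 2 = Suc (Suc j)" "j + 1 = Suc j" by simp_all
  have "(int (2 * j + m + 1) + 3) * gamma_coeff (2 * j + m + 1 + 3) (j + 2) =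
      gamma_step (2 * j + m + 1) (gamma_coeff (2 * j + m + 1 + 2)) (gamma_coeff (2 * j + m + 1 + 1)) (j + 2)"
    by (rule gamma_coeff_rec) (use assms in simp)
  then show ?thesis
    unfolding e gamma_step_def gamma_lift_def j2 shift_seq_simps
    by (simp add: algebra_simps)
qed

text \<open>For m = d + 3 - 2k \<ge> 3 the only coefficient of doubtful sign in
  \<open>gamma_coeff_rec_explicit\<close>, that with 4m - 10, is nonnegative. The cases
  \<open>k \<le> 1\<close> are separate because that form refers to index k - 2.\<close>

lemma gamma_coeff_nonneg_inner:
  assumes "2 * k + 3 \<le> d + 3" "\<And>j. gamma_coeff (d + 2) j \<ge> 0" "\<And>j. gamma_coeff (d + 1) j \<ge> 0"
  shows "gamma_coeff (d + 3) k \<ge> 0"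
proof -
  have "0 \<le> (int d + 3) * gamma_coeff (d + 3) k"
  proof (cases "k \<le> 1")
    case True
    then consider "k = 0" | "k = 1" by linarith
    then show ?thesis
    proof cases
      case 1
      then show ?thesis using assms(2,3) by (simp add: gamma_coeff_rec gamma_step_def gamma_lift_def)
    next
      case 2
      then have "d \<ge> 2" using assms(1) by simp
      then have "(int d - 2) * gamma_coeff (d + 1) 0 \<ge> 0" "(int d - 2) * gamma_coeff (d + 2) 0 \<ge> 0"
        "(int d - 2) * gamma_coeff (d + 1) 1 \<ge> 0"
        using assms(2,3) by simp_all
      moreover have "(int d + 3) * gamma_coeff (d + 3) k = gamma_step d (gamma_coeff (d + 2)) (gamma_coeff (d + 1)) k"
        by (rule gamma_coeff_rec) (use assms(1) in simp)
      ultimately show ?thesis using assms(2)[of 0] assms(3)[of 0] assms(2)[of 1] assms(3)[of 1] 2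
        by (simp add: gamma_step_def gamma_lift_def algebra_simps)
    qed
  next
    case False
    define j m where "j = k - 2" and "m = d + 3 - 2 * k"
    have m: "m \<ge> 3" and k: "k = j + 2" and d: "d + 3 = 2 * j + m + 4"
      using False assms(1) by (simp_all add: j_def m_def)
    then have d': "d + 2 = 2 * j + m + 3" "d + 1 = 2 * j + m + 2" "int d + 3 = 2 * int j + int m + 4" by simp_all
    have "0 \<le> (int j + 1) * (4 * int m - 10) + 2 * int m - 4"
      using m by (intro add_nonneg_nonneg[of _ "2 * int m - 4", simplified add_diff_eq] mult_nonneg_nonneg) simp_all
    then show ?thesis
      using assms(2,3) m
      unfolding d' d k by (subst gamma_coeff_rec_explicit) simp_all
  qed
  then show ?thesis by (simp add: zero_le_mult_iff)
qed

text \<open>Here m = n - 2k, and predecessors are variables so that named rows and indices can be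
  plugged in. The induction uses m = 1, 3, 5 for odd \<open>n\<close> and m = 2, 4 for even
  \<open>n\<close>.\<close>

lemma gamma_coeff_rec_at:
  assumes "n2 + 2 = 2 * k + m" "k = Suc k1" "k1 = Suc k2" "m \<ge> 1" "n1 = Suc n2" "n = Suc n1"
  shows "int n * gamma_coeff n k =
    (int k + 1) * gamma_coeff n1 k + 2 * int m * gamma_coeff n1 k1
    + ((int k + 1) * (int k + 1) + int n2) * gamma_coeff n2 k
    + ((int k - 1) * (4 * int m - 10) + 2 * int m - 4) * gamma_coeff n2 k1
    + 4 * int m * (int m + 1) * gamma_coeff n2 k2"
proof -
  have "n2 = 2 * k2 + m + 2" "n1 = 2 * k2 + m + 3" "n = 2 * k2 + m + 4" "k1 = k2 + 1" "k = k2 + 2"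
    using assms by simp_all
  moreover from this have "int n = 2 * int k2 + int m + 4" "int n2 = 2 * int k2 + int m + 2"
    "int k + 1 = int k2 + 3" "int k - 1 = int k2 + 1"
    by simp_all
  ultimately show ?thesis
    using gamma_coeff_rec_explicit[OF assms(4), of k2] by (simp only:)
qed

lemma row_ok_nonneg: "row_ok n c \<Longrightarrow> 1 \<le> n \<Longrightarrow> 2 * k < n \<Longrightarrow> 0 \<le> c k"
  by (simp add: row_ok_def Let_def del: upt_Suc)

lemma row_ok_odd:
  assumes "n = 2 * t + 1" "t = Suc t1" "t1 = Suc t2" "t \<ge> 4" "\<And>k. k \<le> t1 \<Longrightarrow> 0 \<le> c k"
  shows "row_ok n c \<longleftrightarrow> 0 \<le> c t \<and> (3 * int t + 1) * c t \<le> 4 * c t1 \<and> (int t + 2) * c t1 \<le> 12 * c t2"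
proof -
  have e: "(n - 1) div 2 = t" "odd n" "t - 1 = t1" "t - 2 = t2"
    using assms by simp_all
  have "(\<forall>k\<in>set [0..<Suc t]. 0 \<le> c k) \<longleftrightarrow> 0 \<le> c t"
    using assms by (auto simp: less_Suc_eq_le le_Suc_eq)
  then show ?thesis
    unfolding row_ok_def Let_def e using assms(4) e(2) by simp
qed

lemma row_ok_even:
  assumes "n = 2 * t + 2" "t = Suc t1" "t \<ge> 4" "\<And>k. k \<le> t1 \<Longrightarrow> 0 \<le> c k"
  shows "row_ok n c \<longleftrightarrow> 0 \<le> c t \<and> (int t + 3) * c t \<le> 5 * c t1"
proof -
  have e: "(n - 1) div 2 = t" "even n" "t - 1 = t1"
    using assms by simp_all
  have "(\<forall>k\<in>set [0..<Suc t]. 0 \<le> c k) \<longleftrightarrow> 0 \<le> c t"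
    using assms by (auto simp: less_Suc_eq_le le_Suc_eq)
  then show ?thesis
    unfolding row_ok_def Let_def e using assms(3) e(2) by simp
qed

lemma row_ok_gamma_coeff: "n \<ge> 1 \<Longrightarrow> row_ok n (gamma_coeff n)"
proof (induction n rule: less_induct)
  case (less n)
  show ?case
  proof (cases "n \<le> 48")
    case True
    show ?thesis
    proof (cases "n \<ge> 3")
      case False
      then consider "n = 1" | "n = 2" using less.prems by linarith
      then show ?thesis by cases (simp_all add: row_ok_def eval_nat_numeral)
    qed (use True row_ok_small in auto)
  next
    case False
    have nonneg: "gamma_coeff l k \<ge> 0" if "l < n" for l k
    proof (cases "l \<ge> 1 \<and> 2 * k < l")
      case True
      then show ?thesis using less.IH[OF that] row_ok_nonneg by blast
    qed (use gamma_coeff_eq_0[of l k] in force)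
    define h h1 h2 h3 h4 where "h = (n - 1) div 2" and "h1 = h - 1" and "h2 = h - 2" and "h3 = h - 3" and "h4 = h - 4"
    \<comment> \<open>Row 49 = 2 * 24 + 1 is the first one beyond the computation, just where the
      step lemmas become available. Both preceding rows satisfy the guard of \<open>row_ok\<close>,
      so their bounds can be used.\<close>
    have h24: "h \<ge> 24" using False by (simp add: h_def)
    then have suc: "h = Suc h1" "h1 = Suc h2" "h2 = Suc h3" "h3 = Suc h4"
      by (simp_all add: h1_def h2_def h3_def h4_def)
    define n1 n2 where "n1 = n - 1" and "n2 = n - 2"
    have n: "n = Suc n1" "n1 = Suc n2" using False by (simp_all add: n1_def n2_def)
    have inner: "gamma_coeff n k \<ge> 0" if "k \<le> h1" for k
    proof -
      have "2 * k + 3 \<le> n - 3 + 3" using that False by (simp add: h1_def h_def)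
      then have "gamma_coeff (n - 3 + 3) k \<ge> 0"
        by (rule gamma_coeff_nonneg_inner) (use nonneg False in simp_all)
      then show ?thesis using False by simp
    qed
    have nn: "gamma_coeff n1 k \<ge> 0" "gamma_coeff n2 k \<ge> 0" for k using nonneg n by simp_all
    have hi: "int h1 = int h - 1" "int h2 = int h - 2" using suc by simp_all
    have ge: "h \<ge> 4" "h1 \<ge> 4" "int h \<ge> 24" using h24 suc by simp_all
    have ok: "row_ok n1 (gamma_coeff n1)" "row_ok n2 (gamma_coeff n2)"
      using less.IH n False by simp_all
    show ?thesis
    proof (cases "odd n")
      case True
      then have nh: "n = 2 * h + 1" by (auto simp: h_def elim!: oddE)
      then have n1h: "n1 = 2 * h1 + 2" and n2h: "n2 = 2 * h1 + 1" using n suc by simp_all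
      have hyp: "(int h + 2) * gamma_coeff n1 h1 \<le> 5 * gamma_coeff n1 h2"
        "(3 * int h - 2) * gamma_coeff n2 h1 \<le> 4 * gamma_coeff n2 h2" "(int h + 1) * gamma_coeff n2 h2 \<le> 12 * gamma_coeff n2 h3"
        using ok[unfolded row_ok_even[OF n1h suc(2) ge(2) nn(1)] row_ok_odd[OF n2h suc(2,3) ge(2) nn(2)]]
        by (simp_all add: hi algebra_simps)
      have zero: "gamma_coeff n1 h = 0" "gamma_coeff n2 h = 0"
        using gamma_coeff_eq_0 n nh by simp_all
      have nhi: "int n2 = 2 * int h - 1" "int n = 2 * int h + 1" using nh n by linarith+
      have x: "(2 * int h + 1) * gamma_coeff n h = 2 * gamma_coeff n1 h1 + (4 - 6 * int h) * gamma_coeff n2 h1 + 8 * gamma_coeff n2 h2"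
        using gamma_coeff_rec_at[of n2 h 1 h1 h2 n1 n] suc n nh unfolding zero nhi
        by (simp add: algebra_simps)
      have x1: "(2 * int h + 1) * gamma_coeff n h1 = int h * gamma_coeff n1 h1 + 6 * gamma_coeff n1 h2
          + (int h * int h + 2 * int h - 1) * gamma_coeff n2 h1 + (2 * int h - 2) * gamma_coeff n2 h2 + 48 * gamma_coeff n2 h3"
        using gamma_coeff_rec_at[of n2 h1 3 h2 h3 n1 n, OF _ suc(2,3) _ n(2,1)] suc n nh unfolding nhi hi
        by (simp add: algebra_simps)
      have x2: "(2 * int h + 1) * gamma_coeff n h2 = (int h - 1) * gamma_coeff n1 h2 + 10 * gamma_coeff n1 h3
          + int h * int h * gamma_coeff n2 h2 + (10 * int h - 24) * gamma_coeff n2 h3 + 120 * gamma_coeff n2 h4"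
        using gamma_coeff_rec_at[of n2 h2 5 h3 h4 n1 n, OF _ suc(3,4) _ n(2,1)] suc n nh unfolding nhi hi
        by (simp add: algebra_simps)
      show ?thesis
        using row_ok_odd[of n h h1 h2 "gamma_coeff n"] nh suc(1,2) ge(1) inner
          odd_row_step[OF ge(3) nn(1) nn(1) nn(1) nn(2) nn(2) nn(2) nn(2) hyp x x1 x2] by blast
    next
      case False
      then have nh: "n = 2 * h + 2" using less.prems by (auto simp: h_def elim!: evenE)
      then have n1h: "n1 = 2 * h + 1" and n2h: "n2 = 2 * h1 + 2" using n suc by simp_all
      have hyp: "(3 * int h + 1) * gamma_coeff n1 h \<le> 4 * gamma_coeff n1 h1" "(int h + 2) * gamma_coeff n1 h1 \<le> 12 * gamma_coeff n1 h2"
        "(int h + 2) * gamma_coeff n2 h1 \<le> 5 * gamma_coeff n2 h2"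
        using ok[unfolded row_ok_even[OF n2h suc(2) ge(2) nn(2)] row_ok_odd[OF n1h suc(1,2) ge(1) nn(1)]]
        by (simp_all add: hi algebra_simps)
      have zero: "gamma_coeff n2 h = 0"
        using gamma_coeff_eq_0 n nh by simp_all
      have nhi: "int n2 = 2 * int h" "int n = 2 * int h + 2" using nh n by linarith+
      have y0: "(2 * int h + 2) * gamma_coeff n h = (int h + 1) * gamma_coeff n1 h + 4 * gamma_coeff n1 h1
          + (2 - 2 * int h) * gamma_coeff n2 h1 + 24 * gamma_coeff n2 h2"
        using gamma_coeff_rec_at[of n2 h 2 h1 h2 n1 n, OF _ suc(1,2) _ n(2,1)] suc n nh unfolding zero nhi
        by (simp add: algebra_simps)
      have y1: "(2 * int h + 2) * gamma_coeff n h1 = int h * gamma_coeff n1 h1 + 8 * gamma_coeff n1 h2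
          + (int h * int h + 2 * int h) * gamma_coeff n2 h1 + (6 * int h - 8) * gamma_coeff n2 h2 + 80 * gamma_coeff n2 h3"
        using gamma_coeff_rec_at[of n2 h1 4 h2 h3 n1 n, OF _ suc(2,3) _ n(2,1)] suc n nh unfolding nhi hi
        by (simp add: algebra_simps)
      show ?thesis
        using row_ok_even[of n h h1 "gamma_coeff n"] nh suc(1) ge(1) inner
          even_row_step[OF ge(3) nn(1) nn(1) nn(1) nn(2) nn(2) nn(2) hyp y0 y1] by blast
    qed
  qed
qed

lemma gamma_coeff_nonneg: "gamma_coeff n k \<ge> 0"
proof (cases "n \<ge> 1 \<and> 2 * k < n")
  case True
  then show ?thesis using row_ok_gamma_coeff row_ok_nonneg by blast
qed (use gamma_coeff_eq_0[of n k] in force)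

theorem theorem1:
  fixes n :: nat
  assumes "n \<ge> 1"
  shows "gamma_positive (n - 1) (involution_des_poly n)"
proof -
  have "involution_des_poly n = gamma_expansion (n - 1) (gamma_coeff n)"
    using involution_des_poly_expansion[of "n - 1"] assms by simp
  then show ?thesis
    unfolding gamma_positive_def using palindromic_gamma_expansion gamma_coeff_nonneg by metis
qed

end
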